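(* For a concept class $\mathcal{C}$ of $\pm1$-valued functions on $[N]$, $$R(\mathcal{C})\le O\left(\frac{Q(\mathcal{C})^2}{\log Q(\mathcal{C})}\,\log|\mathcal{C}|\right)\le O\left(\frac{Q(\mathcal{C})^3}{\log Q(\mathcal{C})}\,\log N\right).$$
   Context: $N$ is a positive integer and $[N]=\{1,\dots,N\}$; $O(\cdot)$ hides an absolute constant. A learner knows the class $\mathcal{C}$ and must identify an unknown target $c\in\mathcal{C}$, $c:[N]\to\{-1,1\}$, exactly, accessing $c$ only through membership queries. $R(\mathcal{C})$ is the minimal number of classical membership queries needed by a (randomized, adaptive) classical learner that can exactly identify every $c\in\mathcal{C}$ with error probability at most $1/3$; a classical membership query to $x\in[N]$ returns $c(x)$. $Q(\mathcal{C})$ is the minimal number of quantum membership queries needed by a quantum learner that can exactly identify every $c\in\mathcal{C}$ with error probability at most $1/3$. A quantum membership query is one application of the unitary $O_c:|x,b\rangle\mapsto|x,b\cdot c(x)\rangle$ for $x\in[N]$, $b\in\{-1,1\}$ (tensored with the identity on a workspace register). A $T$-query quantum learner starts in a fixed state, alternates fixed unitaries independent of $c$ with $T$ applications of $O_c$, and finally performs a fixed measurement whose outcome is an element of $\mathcal{C}$. *)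

theory Defs
  imports
    "HOL-Library.FuncSet"
    "HOL-Probability.Probability_Mass_Function"
    "Jordan_Normal_Form.Schur_Decomposition"
begin

type_synonym concept = "nat \<Rightarrow> int"

text \<open>Concepts are extensional functions, so that equality of concepts is equality on \<open>{1..N}\<close>
  and \<open>card C\<close> counts functions on \<open>{1..N}\<close>.\<close>

definition concept_class :: "nat \<Rightarrow> concept set \<Rightarrow> bool" where
  "concept_class N C \<longleftrightarrow> C \<noteq> {} \<and> C \<subseteq> {1..N} \<rightarrow>\<^sub>E {-1, 1}"


section \<open>Classical learners\<close>

text \<open>A deterministic adaptive learner is a decision tree; \<open>Query x l r\<close> continues with \<open>l\<close> on
  answer \<open>-1\<close> and with \<open>r\<close> on answer \<open>1\<close>. A randomized learner is a probability distribution
  on decision trees.\<close>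

datatype decision_tree =
    Output concept
  | Query nat decision_tree decision_tree

fun run_tree :: "decision_tree \<Rightarrow> concept \<Rightarrow> concept" where
  "run_tree (Output h) c = h"
| "run_tree (Query x l r) c = (if c x = 1 then run_tree r c else run_tree l c)"

fun depth :: "decision_tree \<Rightarrow> nat" where
  "depth (Output h) = 0"
| "depth (Query x l r) = Suc (max (depth l) (depth r))"

fun well_formed_tree :: "nat \<Rightarrow> concept set \<Rightarrow> decision_tree \<Rightarrow> bool" where
  "well_formed_tree N C (Output h) \<longleftrightarrow> h \<in> C"
| "well_formed_tree N C (Query x l r) \<longleftrightarrow>
     x \<in> {1..N} \<and> well_formed_tree N C l \<and> well_formed_tree N C r"

definition classical_learner :: "nat \<Rightarrow> concept set \<Rightarrow> nat \<Rightarrow> decision_tree pmf \<Rightarrow> bool" where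
  "classical_learner N C T D \<longleftrightarrow>
     (\<forall>t \<in> set_pmf D. well_formed_tree N C t \<and> depth t \<le> T) \<and>
     (\<forall>c \<in> C. measure_pmf.prob D {t. run_tree t c \<noteq> c} \<le> 1/3)"

definition R :: "nat \<Rightarrow> concept set \<Rightarrow> nat" where
  "R N C = (LEAST T. \<exists>D. classical_learner N C T D)"


section \<open>Quantum learners\<close>

text \<open>The state space is spanned by \<open>|x, b, w\<rangle>\<close> with \<open>x \<in> {1..N}\<close>, \<open>b \<in> {-1, 1}\<close> and \<open>w < W\<close>,
  where \<open>W\<close> is the dimension of the workspace; \<open>basis_index\<close> enumerates this basis by
  \<open>{..<2 * N * W}\<close>.\<close>

definition basis_index :: "nat \<Rightarrow> nat \<Rightarrow> int \<Rightarrow> nat \<Rightarrow> nat" where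
  "basis_index W x b w = (2 * (x - 1) + (if b = 1 then 0 else 1)) * W + w"

definition query_mat :: "nat \<Rightarrow> nat \<Rightarrow> concept \<Rightarrow> complex mat" where
  "query_mat N W c = Matrix.mat (2 * N * W) (2 * N * W) (\<lambda>(i, j).
     if \<exists>x \<in> {1..N}. \<exists>b \<in> {-1, 1}. \<exists>w < W.
          j = basis_index W x b w \<and> i = basis_index W x (b * c x) w
     then 1 else 0)"

definition unitary_mat :: "nat \<Rightarrow> complex mat \<Rightarrow> bool" where
  "unitary_mat d U \<longleftrightarrow>
     U \<in> carrier_mat d d \<and> mat_adjoint U * U = 1\<^sub>m d \<and> U * mat_adjoint U = 1\<^sub>m d"

definition sq_norm :: "complex vec \<Rightarrow> real" where
  "sq_norm v = Re (v \<bullet>c v)"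

text \<open>A measurement with outcomes in \<open>C\<close> is given by measurement operators \<open>M c\<close> with
  \<open>\<Sum>c. (M c)\<^sup>\<dagger> M c = 1\<close>; outcome \<open>c\<close> has probability \<open>\<parallel>M c \<psi>\<parallel>\<^sup>2\<close> in state \<open>\<psi>\<close>.
  Projective measurements and POVMs are covered.\<close>

definition measurement :: "nat \<Rightarrow> concept set \<Rightarrow> (concept \<Rightarrow> complex mat) \<Rightarrow> bool" where
  "measurement d C M \<longleftrightarrow>
     (\<forall>c \<in> C. M c \<in> carrier_mat d d) \<and>
     Matrix.mat d d (\<lambda>(i, j). \<Sum>c \<in> C. (mat_adjoint (M c) * M c) $$ (i, j)) = 1\<^sub>m d"

fun quantum_state ::
  "nat \<Rightarrow> nat \<Rightarrow> complex vec \<Rightarrow> (nat \<Rightarrow> complex mat) \<Rightarrow> concept \<Rightarrow> nat \<Rightarrow> complex vec"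
where
  "quantum_state N W \<psi> U c 0 = U 0 *\<^sub>v \<psi>"
| "quantum_state N W \<psi> U c (Suc t) =
     U (Suc t) *\<^sub>v (query_mat N W c *\<^sub>v quantum_state N W \<psi> U c t)"

definition quantum_learner ::
  "nat \<Rightarrow> concept set \<Rightarrow> nat \<Rightarrow> nat \<Rightarrow> complex vec \<Rightarrow> (nat \<Rightarrow> complex mat) \<Rightarrow>
    (concept \<Rightarrow> complex mat) \<Rightarrow> bool"
where
  "quantum_learner N C T W \<psi> U M \<longleftrightarrow>
     \<psi> \<in> carrier_vec (2 * N * W) \<and> sq_norm \<psi> = 1 \<and>
     (\<forall>t \<le> T. unitary_mat (2 * N * W) (U t)) \<and>
     measurement (2 * N * W) C M \<and>
     (\<forall>c \<in> C. 1 - sq_norm (M c *\<^sub>v quantum_state N W \<psi> U c T) \<le> 1/3)"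

definition Q :: "nat \<Rightarrow> concept set \<Rightarrow> nat" where
  "Q N C = (LEAST T. \<exists>W \<psi> U M. quantum_learner N C T W \<psi> U M)"

lemma basis_index_less:
  assumes "x \<in> {1..N}" "w < W"
  shows "basis_index W x b w < 2 * N * W"
proof -
  define k where "k = 2 * (x - 1) + (if b = 1 then 0 else 1 :: nat)"
  have "k + 1 \<le> 2 * N" using assms(1) by (auto simp: k_def)
  hence "(k + 1) * W \<le> 2 * N * W" by (rule mult_le_mono1)
  thus ?thesis using assms(2) by (simp add: basis_index_def k_def)
qed

lemma basis_index_inj:
  assumes "basis_index W x b w = basis_index W x' b' w'" "w < W" "w' < W"
    and "x \<in> {1..N}" "x' \<in> {1..N}" "b \<in> {-1, 1}" "b' \<in> {-1, 1}"
  shows "x = x' \<and> b = b' \<and> w = w'"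
proof -
  define k where "k = 2 * (x - 1) + (if b = 1 then 0 else 1 :: nat)"
  define k' where "k' = 2 * (x' - 1) + (if b' = 1 then 0 else 1 :: nat)"
  have e: "k * W + w = k' * W + w'"
    using assms(1) by (simp add: basis_index_def k_def k'_def)
  have w: "w = w'"
    using arg_cong[OF e, of "\<lambda>n. n mod W"] assms(2,3) by simp
  hence "k = k'" using e assms(2) by auto
  have "x - 1 = x' - 1"
    using arg_cong[OF \<open>k = k'\<close>, of "\<lambda>n. n div 2"] by (simp add: k_def k'_def)
  hence x: "x = x'" using assms(4,5) unfolding atLeastAtMost_iff by linarith
  have "(if b = 1 then 0 else 1 :: nat) = (if b' = 1 then 0 else 1)"
    using \<open>k = k'\<close> x by (simp add: k_def k'_def)
  hence "b = 1 \<longleftrightarrow> b' = 1" by (metis zero_neq_one)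
  hence "b = b'" using assms(6,7) by blast
  with w x show ?thesis by simp
qed

lemma query_mat_carrier: "query_mat N W c \<in> carrier_mat (2 * N * W) (2 * N * W)"
  unfolding query_mat_def by (rule mat_carrier)

lemma query_mat_basis:
  assumes "c \<in> {1..N} \<rightarrow>\<^sub>E {-1, 1}" "x \<in> {1..N}" "b \<in> {-1, 1}" "w < W"
  shows "query_mat N W c *\<^sub>v unit_vec (2 * N * W) (basis_index W x b w) =
    unit_vec (2 * N * W) (basis_index W x (b * c x) w)"
proof (rule eq_vecI)
  define d where "d = 2 * N * W"
  define A where "A = query_mat N W c"
  define j where "j = basis_index W x b w"
  define k where "k = basis_index W x (b * c x) w"
  have A: "A \<in> carrier_mat d d" unfolding A_def d_def by (rule query_mat_carrier)
  have j: "j < d" unfolding j_def d_def using assms(2,4) by (rule basis_index_less)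
  fix i assume "i < dim_vec (unit_vec (2 * N * W) (basis_index W x (b * c x) w) :: complex vec)"
  hence i: "i < d" by (simp add: d_def)
  have iff: "(\<exists>x' \<in> {1..N}. \<exists>b' \<in> {-1, 1}. \<exists>w' < W. j = basis_index W x' b' w' \<and>
      i = basis_index W x' (b' * c x') w') \<longleftrightarrow> i = k" (is "?P \<longleftrightarrow> _")
  proof
    assume ?P
    then obtain x' b' w' where *: "x' \<in> {1..N}" "b' \<in> {-1, 1}" "w' < W"
      "j = basis_index W x' b' w'" "i = basis_index W x' (b' * c x') w'"
      by (elim bexE exE conjE)
    have "x = x' \<and> b = b' \<and> w = w'"
      by (rule basis_index_inj[OF *(4)[unfolded j_def] assms(4) *(3) assms(2) *(1) assms(3) *(2)])
    with *(5) show "i = k" by (simp only: k_def)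
  next
    assume "i = k"
    thus ?P unfolding j_def k_def
      by (intro bexI[OF _ assms(2)] bexI[OF _ assms(3)] exI[of _ w] conjI assms(4) refl)
  qed
  have Aij: "A $$ (i, j) = (if i = k then 1 else 0)"
    unfolding A_def query_mat_def d_def[symmetric] index_mat(1)[OF i j] prod.case iff ..
  have "vec_index (A *\<^sub>v unit_vec d j) i = scalar_prod (Matrix.row A i) (unit_vec d j)"
    using A i by simp
  also have "\<dots> = A $$ (i, j)"
    using A i j by simp
  also have "\<dots> = vec_index (unit_vec d k) i"
    using i by (simp add: Aij unit_vec_def)
  finally show "vec_index (query_mat N W c *\<^sub>v unit_vec (2 * N * W) (basis_index W x b w)) i =
      vec_index (unit_vec (2 * N * W) (basis_index W x (b * c x) w)) i"
    unfolding A_def d_def j_def k_def .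
qed (simp only: dim_mult_mat_vec index_unit_vec carrier_matD[OF query_mat_carrier])

end

theory Submission
  imports Defs "HOL-Analysis.Harmonic_Numbers"
begin

text \<open>Fix a quantum learner with \<open>T\<close> queries and a distribution on concepts in which no concept
  has weight \<open>5/6\<close>. If at every position one of the two answers had weight below
  \<open>1 / (50 * T)\<^sup>2\<close>, then by the hybrid argument most concepts would be indistinguishable from the
  pointwise majority function, although a single state can be close to the final state of at most
  one concept. So some position has minority weight \<open>p \<ge> 1 / (50 * T)\<^sup>2\<close>; querying it
  classically lowers the entropy, initially at most \<open>ln (card C)\<close>, by about \<open>p * ln (1 / p)\<close> on
  average. It is this entropy drop, rather than \<open>p\<close>, that gains the factor \<open>log T\<close>. Hence every
  distribution on concepts admits a shallow decision tree with small average error, and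
  multiplicative weights (an elementary minimax argument) turn these trees into one randomized
  learner.

  For the second inequality, the final amplitudes are polynomials of degree at most \<open>T\<close> in the
  values of the concept, which bounds the rank of the matrix of outcome probabilities, while
  correctness of the learner makes this matrix nonsingular.\<close>

section \<open>Norms and measurements\<close>

lemma sq_norm_eq_sum:
  assumes "v \<in> carrier_vec d"
  shows "sq_norm v = (\<Sum>i<d. (cmod (vec_index v i))\<^sup>2)"
proof -
  have "v \<bullet>c v = (\<Sum>i<d. vec_index v i * cnj (vec_index v i))"
    using assms by (simp add: scalar_prod_def atLeast0LessThan)
  also have "\<dots> = complex_of_real (\<Sum>i<d. (cmod (vec_index v i))\<^sup>2)"
    by (simp only: of_real_sum complex_norm_square)
  finally show ?thesis by (simp only: sq_norm_def Re_complex_of_real)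
qed

lemma sq_norm_nonneg:
  assumes "v \<in> carrier_vec d"
  shows "sq_norm v \<ge> 0"
  by (simp add: sq_norm_eq_sum[OF assms] sum_nonneg)

lemma sq_norm_unit_vec:
  assumes "j < d"
  shows "sq_norm (unit_vec d j) = 1"
proof -
  have "sq_norm (unit_vec d j) = (\<Sum>i<d. (cmod (vec_index (unit_vec d j) i))\<^sup>2)"
    by (rule sq_norm_eq_sum) simp
  also have "\<dots> = (\<Sum>i<d. if i = j then 1 else 0)"
    by (rule sum.cong) (auto simp: unit_vec_def)
  finally show ?thesis using assms by simp
qed

lemma sq_norm_add_le:
  assumes "u \<in> carrier_vec d" "v \<in> carrier_vec d"
  shows "sqrt (sq_norm (u + v)) \<le> sqrt (sq_norm u) + sqrt (sq_norm v)"
proof -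
  have uv: "u + v \<in> carrier_vec d" using assms by simp
  have "sqrt (sq_norm (u + v)) = L2_set (\<lambda>i. cmod (vec_index u i + vec_index v i)) {..<d}"
    unfolding L2_set_def sq_norm_eq_sum[OF uv] using assms by simp
  also have "\<dots> \<le> L2_set (\<lambda>i. cmod (vec_index u i) + cmod (vec_index v i)) {..<d}"
    by (rule L2_set_mono) (auto intro: norm_triangle_ineq)
  also have "\<dots> \<le> L2_set (\<lambda>i. cmod (vec_index u i)) {..<d} + L2_set (\<lambda>i. cmod (vec_index v i)) {..<d}"
    by (rule L2_set_triangle_ineq)
  finally show ?thesis
    by (simp add: L2_set_def sq_norm_eq_sum[OF assms(1)] sq_norm_eq_sum[OF assms(2)])
qed

lemma sq_norm_diff_triangle:
  assumes "u \<in> carrier_vec d" "v \<in> carrier_vec d" "w \<in> carrier_vec d"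
  shows "sqrt (sq_norm (u - w)) \<le> sqrt (sq_norm (u - v)) + sqrt (sq_norm (v - w))"
proof -
  have "u - w = (u - v) + (v - w)" using assms by (intro eq_vecI) auto
  thus ?thesis using sq_norm_add_le[of "u - v" d "v - w"] assms by simp
qed

lemma index_mult_mat_vec_sum:
  assumes "A \<in> carrier_mat d d" "v \<in> carrier_vec d" "i < d"
  shows "vec_index (A *\<^sub>v v) i = (\<Sum>j<d. A $$ (i, j) * vec_index v j)"
  using assms by (simp add: scalar_prod_def atLeast0LessThan)

text \<open>Unitarity and completeness of a measurement are given as identities for
  \<open>mat_adjoint A * A\<close>. Written as a quadratic form in that product, the norm lets both
  be applied entry by entry.\<close>

lemma sq_norm_mult_mat_vec:
  assumes A: "A \<in> carrier_mat d d" and v: "v \<in> carrier_vec d"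
  shows "sq_norm (A *\<^sub>v v) =
    Re (\<Sum>k<d. \<Sum>j<d. cnj (vec_index v k) * (mat_adjoint A * A) $$ (k, j) * vec_index v j)"
proof -
  have adj: "(mat_adjoint A * A) $$ (k, j) = (\<Sum>i<d. cnj (A $$ (i, k)) * A $$ (i, j))"
    if "k < d" "j < d" for k j
    using A that
    by (simp add: mat_adjoint_def scalar_prod_def atLeast0LessThan)
  have Av: "A *\<^sub>v v \<in> carrier_vec d" using A v by simp
  have "complex_of_real (sq_norm (A *\<^sub>v v)) =
      (\<Sum>i<d. cnj (vec_index (A *\<^sub>v v) i) * vec_index (A *\<^sub>v v) i)"
    unfolding sq_norm_eq_sum[OF Av] of_real_sum
    by (intro sum.cong refl) (simp only: complex_norm_square mult.commute)
  also have "\<dots> = (\<Sum>i<d. (\<Sum>k<d. cnj (A $$ (i, k)) * cnj (vec_index v k)) * (\<Sum>j<d. A $$ (i, j) * vec_index v j))"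
    by (intro sum.cong refl)
       (simp add: index_mult_mat_vec_sum[OF A v] del: index_mult_mat_vec)
  also have "\<dots> = (\<Sum>i<d. \<Sum>k<d. \<Sum>j<d.
      cnj (vec_index v k) * (cnj (A $$ (i, k)) * A $$ (i, j)) * vec_index v j)"
    unfolding sum_product by (intro sum.cong refl) (simp add: mult_ac)
  also have "\<dots> = (\<Sum>k<d. \<Sum>j<d. \<Sum>i<d.
      cnj (vec_index v k) * (cnj (A $$ (i, k)) * A $$ (i, j)) * vec_index v j)"
    by (subst sum.swap, rule sum.cong[OF refl], rule sum.swap)
  also have "\<dots> = (\<Sum>k<d. \<Sum>j<d. cnj (vec_index v k) * (mat_adjoint A * A) $$ (k, j) * vec_index v j)"
    by (intro sum.cong refl) (simp add: adj sum_distrib_left sum_distrib_right)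
  finally show ?thesis by (metis Re_complex_of_real)
qed

lemma quadratic_form_one:
  assumes "v \<in> carrier_vec d"
  shows "Re (\<Sum>k<d. \<Sum>j<d. cnj (vec_index v k) * 1\<^sub>m d $$ (k, j) * vec_index v j) = sq_norm v"
proof -
  have "(\<Sum>k<d. \<Sum>j<d. cnj (vec_index v k) * 1\<^sub>m d $$ (k, j) * vec_index v j) =
      (\<Sum>k<d. \<Sum>j<d. if j = k then cnj (vec_index v k) * vec_index v k else 0)"
    by (intro sum.cong refl) auto
  also have "\<dots> = (\<Sum>k<d. cnj (vec_index v k) * vec_index v k)"
    by simp
  also have "\<dots> = complex_of_real (sq_norm v)"
    unfolding sq_norm_eq_sum[OF assms] of_real_sum
    by (intro sum.cong refl) (simp only: complex_norm_square mult.commute)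
  finally show ?thesis by simp
qed

lemma sq_norm_unitary:
  assumes "unitary_mat d U" "v \<in> carrier_vec d"
  shows "sq_norm (U *\<^sub>v v) = sq_norm v"
  using assms sq_norm_mult_mat_vec[of U d v] quadratic_form_one[of v d]
  by (simp add: unitary_mat_def)

text \<open>Outcome probabilities add up to the squared norm: by completeness the quadratic forms of
  the operators sum to the form of the identity matrix.\<close>

lemma measurement_sum_sq_norm:
  assumes M: "measurement d C M" and v: "v \<in> carrier_vec d"
  shows "(\<Sum>c\<in>C. sq_norm (M c *\<^sub>v v)) = sq_norm v"
proof -
  have entry: "(\<Sum>c\<in>C. (mat_adjoint (M c) * M c) $$ (k, j)) = 1\<^sub>m d $$ (k, j)"
    if "k < d" "j < d" for k j
  proof -
    have "Matrix.mat d d (\<lambda>(i, j). \<Sum>c\<in>C. (mat_adjoint (M c) * M c) $$ (i, j)) $$ (k, j) =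
        1\<^sub>m d $$ (k, j)"
      using M by (simp add: measurement_def)
    thus ?thesis using that by simp
  qed
  have "(\<Sum>c\<in>C. sq_norm (M c *\<^sub>v v)) =
      Re (\<Sum>c\<in>C. \<Sum>k<d. \<Sum>j<d.
        cnj (vec_index v k) * (mat_adjoint (M c) * M c) $$ (k, j) * vec_index v j)"
    unfolding Re_sum[of _ C] using M v
    by (intro sum.cong refl sq_norm_mult_mat_vec) (auto simp: measurement_def)
  also have "(\<Sum>c\<in>C. \<Sum>k<d. \<Sum>j<d.
        cnj (vec_index v k) * (mat_adjoint (M c) * M c) $$ (k, j) * vec_index v j) =
      (\<Sum>k<d. \<Sum>j<d. \<Sum>c\<in>C.
        cnj (vec_index v k) * (mat_adjoint (M c) * M c) $$ (k, j) * vec_index v j)"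
    by (subst sum.swap, rule sum.cong[OF refl], rule sum.swap)
  also have "\<dots> = (\<Sum>k<d. \<Sum>j<d. cnj (vec_index v k) * 1\<^sub>m d $$ (k, j) * vec_index v j)"
    by (intro sum.cong refl) (simp add: entry[symmetric] sum_distrib_left sum_distrib_right del: index_one_mat)
  finally show ?thesis by (simp only: quadratic_form_one[OF v])
qed


section \<open>Queries\<close>

lemma concept_class_finite:
  assumes "concept_class N C"
  shows "finite C"
proof (rule finite_subset)
  show "C \<subseteq> {1..N} \<rightarrow>\<^sub>E {-1, 1}" using assms by (simp add: concept_class_def)
  show "finite ({1..N} \<rightarrow>\<^sub>E {-1, 1 :: int})" by (intro finite_PiE) auto
qed

text \<open>Surjectivity comes from counting: the encoding is injective and both sides have
  \<open>2 * N * W\<close> elements.\<close>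

lemma basis_index_bij:
  "bij_betw (\<lambda>(x, b, w). basis_index W x b w) ({1..N} \<times> {-1, 1} \<times> {..<W}) {..<2 * N * W}"
proof -
  let ?f = "\<lambda>(x, b, w). basis_index W x b w"
  let ?D = "{1..N} \<times> {-1, 1 :: int} \<times> {..<W}"
  have inj: "inj_on ?f ?D"
  proof (rule inj_onI)
    fix p q assume p: "p \<in> ?D" and q: "q \<in> ?D" and eq: "?f p = ?f q"
    obtain x b w x' b' w' where pq: "p = (x, b, w)" "q = (x', b', w')"
      by (cases p, cases q)
    have "x = x' \<and> b = b' \<and> w = w'"
      by (rule basis_index_inj[of W x b w x' b' w' N]) (use p q eq pq in \<open>simp_all del: atLeastAtMost_iff\<close>)
    thus "p = q" by (simp add: pq)
  qed
  have sub: "?f ` ?D \<subseteq> {..<2 * N * W}"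
    using basis_index_less by (auto simp del: atLeastAtMost_iff)
  have "card (?f ` ?D) = card {..<2 * N * W}"
    unfolding card_image[OF inj] by simp
  hence "?f ` ?D = {..<2 * N * W}"
    using sub by (intro card_subset_eq) auto
  with inj show ?thesis by (simp add: bij_betw_def)
qed

lemma sum_basis_index:
  fixes F :: "nat \<Rightarrow> 'a :: comm_monoid_add"
  shows "(\<Sum>i<2 * N * W. F i) =
    (\<Sum>x\<in>{1..N}. \<Sum>w<W. F (basis_index W x 1 w) + F (basis_index W x (-1) w))"
proof -
  have "(\<Sum>i<2 * N * W. F i) =
      (\<Sum>(x, b, w)\<in>{1..N} \<times> {-1, 1} \<times> {..<W}. F (basis_index W x b w))"
    using sum.reindex_bij_betw[OF basis_index_bij[of W N], of F]
    by (simp add: case_prod_unfold)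
  also have "\<dots> = (\<Sum>x\<in>{1..N}. \<Sum>b\<in>{-1, 1}. \<Sum>w<W. F (basis_index W x b w))"
    by (simp add: sum.cartesian_product[symmetric])
  also have "\<dots> = (\<Sum>x\<in>{1..N}. \<Sum>w<W. \<Sum>b\<in>{-1, 1}. F (basis_index W x b w))"
    by (rule sum.cong[OF refl], rule sum.swap)
  finally show ?thesis by (simp add: add.commute)
qed

text \<open>The oracle is an involution because \<open>c x * c x = 1\<close>. So the only column
  with a nonzero entry in a given row is found by applying the same flip of the answer bit to the
  row index.\<close>

lemma query_mat_mult_index:
  assumes c: "c \<in> {1..N} \<rightarrow>\<^sub>E {-1, 1}" and v: "v \<in> carrier_vec (2 * N * W)"
    and x: "x \<in> {1..N}" and b: "b \<in> {-1, 1}" and w: "w < W"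
  shows "vec_index (query_mat N W c *\<^sub>v v) (basis_index W x b w) =
    vec_index v (basis_index W x (b * c x) w)"
proof -
  define d where "d = 2 * N * W"
  define i where "i = basis_index W x b w"
  define k where "k = basis_index W x (b * c x) w"
  have i: "i < d" unfolding i_def d_def using x w by (rule basis_index_less)
  have k: "k < d" unfolding k_def d_def using x w by (rule basis_index_less)
  have cx: "c x \<in> {-1, 1}" using c x by (auto simp: PiE_iff)
  have cc: "b * c x * c x = b" "b * c x \<in> {-1, 1}" using cx b by auto
  have entry: "query_mat N W c $$ (i, j) = (if j = k then 1 else 0)" if j: "j < d" for j
  proof -
    have "(\<exists>x' \<in> {1..N}. \<exists>b' \<in> {-1, 1}. \<exists>w' < W. j = basis_index W x' b' w' \<and>
        i = basis_index W x' (b' * c x') w') \<longleftrightarrow> j = k" (is "?P \<longleftrightarrow> _")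
    proof
      assume ?P
      then obtain x' b' w' where *: "x' \<in> {1..N}" "b' \<in> {-1, 1}" "w' < W"
        "j = basis_index W x' b' w'" "i = basis_index W x' (b' * c x') w'"
        by (elim bexE exE conjE)
      have cx': "c x' \<in> {-1, 1}" using c *(1) by (auto simp: PiE_iff)
      have "b' * c x' \<in> {-1, 1}" using cx' *(2) by auto
      hence "x = x' \<and> b = b' * c x' \<and> w = w'"
        using basis_index_inj[OF _ w *(3) x *(1) b] *(5) unfolding i_def by blast
      moreover have "b' * c x' * c x' = b'" using cx' by auto
      ultimately show "j = k" using *(4) by (simp only: k_def)
    next
      assume "j = k"
      show ?P
      proof (intro bexI[OF _ x] bexI[OF _ cc(2)] exI[of _ w] conjI w)
        show "j = basis_index W x (b * c x) w" using \<open>j = k\<close> by (simp only: k_def)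
        show "i = basis_index W x (b * c x * c x) w" by (simp only: cc(1) i_def)
      qed
    qed
    thus ?thesis
      unfolding query_mat_def d_def[symmetric] index_mat(1)[OF i j] prod.case by (simp only:)
  qed
  have "vec_index (query_mat N W c *\<^sub>v v) i = (\<Sum>j<d. query_mat N W c $$ (i, j) * vec_index v j)"
    by (rule index_mult_mat_vec_sum) (use query_mat_carrier v i in \<open>auto simp: d_def\<close>)
  also have "\<dots> = (\<Sum>j<d. if j = k then vec_index v j else 0)"
    by (intro sum.cong refl) (simp add: entry)
  also have "\<dots> = vec_index v k" using k by simp
  finally show ?thesis by (simp only: i_def k_def)
qed

text \<open>The query magnitude of the hybrid argument: for a unit vector \<open>v\<close>, the
  probability that measuring the query register yields \<open>x\<close>.\<close>

definition position_mass :: "nat \<Rightarrow> complex vec \<Rightarrow> nat \<Rightarrow> real" where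
  "position_mass W v x = (\<Sum>w<W. (cmod (vec_index v (basis_index W x 1 w)))\<^sup>2 +
    (cmod (vec_index v (basis_index W x (-1) w)))\<^sup>2)"

lemma sum_position_mass:
  assumes "v \<in> carrier_vec (2 * N * W)"
  shows "(\<Sum>x\<in>{1..N}. position_mass W v x) = sq_norm v"
  by (simp only: sq_norm_eq_sum[OF assms] sum_basis_index position_mass_def)

lemma query_mat_mult_carrier:
  assumes "v \<in> carrier_vec (2 * N * W)"
  shows "query_mat N W c *\<^sub>v v \<in> carrier_vec (2 * N * W)"
  using query_mat_carrier assms by (rule mult_mat_vec_carrier)

text \<open>An oracle at most swaps the two amplitudes that share \<open>x\<close> and
  \<open>w\<close>, so it preserves the mass at every position.\<close>

lemma sq_norm_query_mat:
  assumes c: "c \<in> {1..N} \<rightarrow>\<^sub>E {-1, 1}" and v: "v \<in> carrier_vec (2 * N * W)"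
  shows "sq_norm (query_mat N W c *\<^sub>v v) = sq_norm v"
proof -
  have "position_mass W (query_mat N W c *\<^sub>v v) x = position_mass W v x" if x: "x \<in> {1..N}" for x
  proof -
    have "c x = -1 \<or> c x = 1" using c x by (auto simp: PiE_iff)
    thus ?thesis unfolding position_mass_def
      by (intro sum.cong refl) (auto simp: query_mat_mult_index[OF c v x])
  qed
  thus ?thesis
    using sum_position_mass[OF v] sum_position_mass[OF query_mat_mult_carrier[OF v]]
    by (metis (no_types, lifting) sum.cong)
qed

text \<open>Where the oracles agree, the difference vanishes. Where they disagree, one swaps the two
  amplitudes \<open>?p\<close>, \<open>?q\<close> of the answer bit and the other does not, so both
  entries have modulus \<open>cmod (?p - ?q)\<close>. The factor 4 is 2 entries times the 2 in |p -
  q|^2 \<le> 2|p|^2 + 2|q|^2.\<close>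

lemma sq_norm_query_mat_diff:
  assumes c: "c \<in> {1..N} \<rightarrow>\<^sub>E {-1, 1}" and m: "m \<in> {1..N} \<rightarrow>\<^sub>E {-1, 1}"
    and v: "v \<in> carrier_vec (2 * N * W)"
  shows "sq_norm (query_mat N W c *\<^sub>v v - query_mat N W m *\<^sub>v v) \<le>
    (\<Sum>x\<in>{1..N}. if c x \<noteq> m x then 4 * position_mass W v x else 0)"
proof -
  let ?u = "query_mat N W c *\<^sub>v v - query_mat N W m *\<^sub>v v"
  have u: "?u \<in> carrier_vec (2 * N * W)" using query_mat_mult_carrier[OF v] by simp
  have sq: "(cmod (a - b))\<^sup>2 \<le> 2 * (cmod a)\<^sup>2 + 2 * (cmod b)\<^sup>2" for a b :: complex
  proof -
    have "(cmod (a - b))\<^sup>2 \<le> (cmod a + cmod b)\<^sup>2"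
      by (intro power_mono norm_triangle_ineq4) simp
    also have "\<dots> \<le> 2 * (cmod a)\<^sup>2 + 2 * (cmod b)\<^sup>2"
      using sum_squares_bound[of "cmod a" "cmod b"] by (simp add: power2_sum)
    finally show ?thesis .
  qed
  have "position_mass W ?u x \<le> (if c x \<noteq> m x then 4 * position_mass W v x else 0)"
    if x: "x \<in> {1..N}" for x
  proof -
    have vals: "c x = -1 \<or> c x = 1" "m x = -1 \<or> m x = 1" using c m x by (auto simp: PiE_iff)
    have idx: "vec_index ?u (basis_index W x b w) =
        vec_index v (basis_index W x (b * c x) w) - vec_index v (basis_index W x (b * m x) w)"
      if "b \<in> {-1, 1}" "w < W" for b w
    proof -
      have "basis_index W x b w < dim_vec (query_mat N W m *\<^sub>v v)"
        unfolding carrier_vecD[OF query_mat_mult_carrier[OF v]]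
        using x that(2) by (rule basis_index_less)
      thus ?thesis
        by (subst index_minus_vec) (simp_all only: query_mat_mult_index[OF c v x that]
            query_mat_mult_index[OF m v x that])
    qed
    show ?thesis
    proof (cases "c x = m x")
      case True
      thus ?thesis by (simp add: position_mass_def idx)
    next
      case False
      have "position_mass W ?u x \<le> (\<Sum>w<W. 4 * ((cmod (vec_index v (basis_index W x 1 w)))\<^sup>2 +
          (cmod (vec_index v (basis_index W x (-1) w)))\<^sup>2))"
        unfolding position_mass_def
      proof (rule sum_mono)
        fix w assume "w \<in> {..<W}"
        hence w: "w < W" by simp
        let ?p = "vec_index v (basis_index W x 1 w)" and ?q = "vec_index v (basis_index W x (-1) w)"
        have "(cmod (vec_index ?u (basis_index W x 1 w)))\<^sup>2 = (cmod (?p - ?q))\<^sup>2"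
          "(cmod (vec_index ?u (basis_index W x (-1) w)))\<^sup>2 = (cmod (?p - ?q))\<^sup>2"
          using vals False idx[OF _ w, of 1] idx[OF _ w, of "-1"]
          by (auto simp: norm_minus_commute)
        thus "(cmod (vec_index ?u (basis_index W x 1 w)))\<^sup>2 +
            (cmod (vec_index ?u (basis_index W x (-1) w)))\<^sup>2 \<le> 4 * ((cmod ?p)\<^sup>2 + (cmod ?q)\<^sup>2)"
          using sq[of ?p ?q] by simp
      qed
      thus ?thesis using False by (simp add: position_mass_def sum_distrib_left)
    qed
  qed
  hence "(\<Sum>x\<in>{1..N}. position_mass W ?u x) \<le>
      (\<Sum>x\<in>{1..N}. if c x \<noteq> m x then 4 * position_mass W v x else 0)"
    by (rule sum_mono)
  thus ?thesis by (simp only: sum_position_mass[OF u])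
qed


section \<open>The hybrid argument\<close>

lemma quantum_state_carrier:
  assumes "\<psi> \<in> carrier_vec (2 * N * W)"
    and "\<And>s. s \<le> t \<Longrightarrow> unitary_mat (2 * N * W) (U s)"
  shows "quantum_state N W \<psi> U c t \<in> carrier_vec (2 * N * W)"
  using assms
proof (induction t)
  case 0
  thus ?case by (auto simp: unitary_mat_def intro!: mult_mat_vec_carrier)
next
  case (Suc t)
  have "quantum_state N W \<psi> U c t \<in> carrier_vec (2 * N * W)" using Suc by auto
  hence "query_mat N W c *\<^sub>v quantum_state N W \<psi> U c t \<in> carrier_vec (2 * N * W)"
    by (rule query_mat_mult_carrier)
  moreover have "U (Suc t) \<in> carrier_mat (2 * N * W) (2 * N * W)"
    using Suc.prems(2)[of "Suc t"] by (simp add: unitary_mat_def)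
  ultimately show ?case by (auto intro: mult_mat_vec_carrier)
qed

lemma sq_norm_quantum_state:
  assumes psi: "\<psi> \<in> carrier_vec (2 * N * W)" and norm: "sq_norm \<psi> = 1"
    and U: "\<And>s. s \<le> t \<Longrightarrow> unitary_mat (2 * N * W) (U s)"
    and c: "c \<in> {1..N} \<rightarrow>\<^sub>E {-1, 1}"
  shows "sq_norm (quantum_state N W \<psi> U c t) = 1"
  using U
proof (induction t)
  case 0
  thus ?case using sq_norm_unitary[OF _ psi] norm by auto
next
  case (Suc t)
  have car: "quantum_state N W \<psi> U c t \<in> carrier_vec (2 * N * W)"
    using Suc.prems by (intro quantum_state_carrier psi) auto
  show ?case
    using Suc sq_norm_unitary[OF Suc.prems[OF le_refl] query_mat_mult_carrier[OF car]]
      sq_norm_query_mat[OF c car]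
    by simp
qed

text \<open>Replacing one oracle by the other in a single query moves the state
  only by its mass on the positions where the two oracles disagree.\<close>

lemma quantum_state_diff:
  assumes psi: "\<psi> \<in> carrier_vec (2 * N * W)"
    and U: "\<And>s. s \<le> t \<Longrightarrow> unitary_mat (2 * N * W) (U s)"
    and c: "c \<in> {1..N} \<rightarrow>\<^sub>E {-1, 1}" and m: "m \<in> {1..N} \<rightarrow>\<^sub>E {-1, 1}"
  shows "sqrt (sq_norm (quantum_state N W \<psi> U c t - quantum_state N W \<psi> U m t)) \<le>
    (\<Sum>s<t. sqrt (\<Sum>x\<in>{1..N}.
      if c x \<noteq> m x then 4 * position_mass W (quantum_state N W \<psi> U m s) x else 0))"
  using U
proof (induction t)
  case 0
  have "U 0 *\<^sub>v \<psi> \<in> carrier_vec (2 * N * W)"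
    using quantum_state_carrier[OF psi, of 0 U c] 0 by simp
  thus ?case by (simp add: sq_norm_eq_sum[of _ "2 * N * W"])
next
  case (Suc t)
  let ?d = "2 * N * W"
  let ?O = "query_mat N W"
  define u where "u = quantum_state N W \<psi> U c t"
  define v where "v = quantum_state N W \<psi> U m t"
  have u: "u \<in> carrier_vec ?d" and v: "v \<in> carrier_vec ?d"
    unfolding u_def v_def using Suc.prems by (auto intro!: quantum_state_carrier psi)
  have uni: "unitary_mat ?d (U (Suc t))" using Suc.prems by simp
  have Ocar: "?O f *\<^sub>v w \<in> carrier_vec ?d" if "w \<in> carrier_vec ?d" for f w
    using that by (rule query_mat_mult_carrier)
  have "U (Suc t) *\<^sub>v (?O c *\<^sub>v u) - U (Suc t) *\<^sub>v (?O m *\<^sub>v v) =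
      U (Suc t) *\<^sub>v (?O c *\<^sub>v u - ?O m *\<^sub>v v)"
    using uni Ocar[OF u] Ocar[OF v]
    by (intro mult_minus_distrib_mat_vec[symmetric]) (auto simp: unitary_mat_def)
  hence "sqrt (sq_norm (quantum_state N W \<psi> U c (Suc t) - quantum_state N W \<psi> U m (Suc t))) =
      sqrt (sq_norm (?O c *\<^sub>v u - ?O m *\<^sub>v v))"
    using sq_norm_unitary[OF uni, of "?O c *\<^sub>v u - ?O m *\<^sub>v v"] Ocar[OF u, of c] Ocar[OF v, of m]
    by (simp add: u_def v_def)
  \<comment> \<open>Passing through \<open>?O c *\<^sub>v v\<close> makes the new error term depend
    only on the run with oracle \<open>m\<close>; the other term is the old error, moved by an
    isometry.\<close>
  also have "\<dots> \<le> sqrt (sq_norm (?O c *\<^sub>v u - ?O c *\<^sub>v v)) + sqrt (sq_norm (?O c *\<^sub>v v - ?O m *\<^sub>v v))"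
    by (rule sq_norm_diff_triangle[OF Ocar[OF u] Ocar[OF v] Ocar[OF v]])
  also have "?O c *\<^sub>v u - ?O c *\<^sub>v v = ?O c *\<^sub>v (u - v)"
    by (rule mult_minus_distrib_mat_vec[OF query_mat_carrier u v, symmetric])
  also have "sq_norm (?O c *\<^sub>v (u - v)) = sq_norm (u - v)"
    by (rule sq_norm_query_mat[OF c]) (use u v in simp)
  also have "sqrt (sq_norm (?O c *\<^sub>v v - ?O m *\<^sub>v v)) \<le>
      sqrt (\<Sum>x\<in>{1..N}. if c x \<noteq> m x then 4 * position_mass W v x else 0)"
    using sq_norm_query_mat_diff[OF c m v] by (rule real_sqrt_le_mono)
  finally show ?case
    using Suc.IH Suc.prems unfolding u_def v_def by simp
qed

lemma position_mass_nonneg: "position_mass W v x \<ge> 0"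
  by (simp add: position_mass_def sum_nonneg)

text \<open>All query masses belong to the run on the reference \<open>m\<close> and so do not
  depend on \<open>c\<close>. Hence the sums over concepts and positions can be swapped: each
  position contributes its mass times a disagreement weight of at most \<delta>, and the masses in
  each step sum to 1. Cauchy-Schwarz over the \<open>T\<close> steps gives the second factor
  \<open>T\<close>.\<close>

lemma sum_weighted_quantum_state_diff:
  fixes w :: "concept \<Rightarrow> real"
  assumes psi: "\<psi> \<in> carrier_vec (2 * N * W)" "sq_norm \<psi> = 1"
    and U: "\<And>s. s \<le> T \<Longrightarrow> unitary_mat (2 * N * W) (U s)"
    and S: "finite S" "S \<subseteq> {1..N} \<rightarrow>\<^sub>E {-1, 1}" and m: "m \<in> {1..N} \<rightarrow>\<^sub>E {-1, 1}"
    and w: "\<And>c. c \<in> S \<Longrightarrow> w c \<ge> 0"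
    and disagree: "\<And>x. x \<in> {1..N} \<Longrightarrow> (\<Sum>c\<in>{c \<in> S. c x \<noteq> m x}. w c) \<le> \<delta>"
  shows "(\<Sum>c\<in>S. w c * sq_norm (quantum_state N W \<psi> U c T - quantum_state N W \<psi> U m T)) \<le>
    4 * (real T)\<^sup>2 * \<delta>"
proof -
  define p where "p s x = position_mass W (quantum_state N W \<psi> U m s) x" for s x
  define D where "D c s = (\<Sum>x\<in>{1..N}. if c x \<noteq> m x then 4 * p s x else 0)" for c :: concept and s
  have p0: "p s x \<ge> 0" for s x by (simp add: p_def position_mass_nonneg)
  have D0: "D c s \<ge> 0" for c s unfolding D_def by (intro sum_nonneg) (simp add: p0)
  have diff: "sq_norm (quantum_state N W \<psi> U c T - quantum_state N W \<psi> U m T) \<le> real T * (\<Sum>s<T. D c s)"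
    if "c \<in> S" for c
  proof -
    let ?v = "quantum_state N W \<psi> U c T - quantum_state N W \<psi> U m T"
    have "?v \<in> carrier_vec (2 * N * W)"
      using quantum_state_carrier[OF psi(1) U] by simp
    hence v0: "sq_norm ?v \<ge> 0" by (rule sq_norm_nonneg)
    have "sqrt (sq_norm ?v) \<le> (\<Sum>s<T. sqrt (D c s))"
      unfolding D_def p_def by (rule quantum_state_diff) (use psi U S m that in auto)
    hence "(sqrt (sq_norm ?v))\<^sup>2 \<le> (\<Sum>s<T. sqrt (D c s) * 1)\<^sup>2"
      by (intro power_mono) (auto simp: v0)
    also have "\<dots> \<le> (\<Sum>s<T. (sqrt (D c s))\<^sup>2) * (\<Sum>s<T. 1\<^sup>2)"
      by (rule Cauchy_Schwarz_ineq_sum)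
    finally show ?thesis using v0 D0 by (simp add: mult.commute)
  qed
  have query: "(\<Sum>c\<in>S. w c * D c s) \<le> 4 * \<delta>" if "s < T" for s
  proof -
    have "(\<Sum>c\<in>S. w c * D c s) = (\<Sum>c\<in>S. \<Sum>x\<in>{1..N}. if c x \<noteq> m x then 4 * p s x * w c else 0)"
      unfolding D_def sum_distrib_left by (intro sum.cong refl) auto
    also have "\<dots> = (\<Sum>x\<in>{1..N}. \<Sum>c\<in>S. if c x \<noteq> m x then 4 * p s x * w c else 0)"
      by (rule sum.swap)
    also have "\<dots> = (\<Sum>x\<in>{1..N}. 4 * p s x * (\<Sum>c\<in>{c \<in> S. c x \<noteq> m x}. w c))"
      by (auto simp: sum.inter_filter[OF S(1)] sum_distrib_left intro!: sum.cong)
    also have "\<dots> \<le> (\<Sum>x\<in>{1..N}. 4 * p s x * \<delta>)"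
      by (intro sum_mono mult_left_mono disagree) (auto simp: p0)
    also have "\<dots> = 4 * \<delta> * (\<Sum>x\<in>{1..N}. p s x)"
      by (simp add: sum_distrib_left mult_ac)
    also have "(\<Sum>x\<in>{1..N}. p s x) = 1"
      unfolding p_def using that U
      by (subst sum_position_mass) (auto intro!: quantum_state_carrier sq_norm_quantum_state psi m)
    finally show ?thesis by simp
  qed
  have "(\<Sum>c\<in>S. w c * sq_norm (quantum_state N W \<psi> U c T - quantum_state N W \<psi> U m T)) \<le>
      (\<Sum>c\<in>S. w c * (real T * (\<Sum>s<T. D c s)))"
    by (intro sum_mono mult_left_mono diff w)
  also have "\<dots> = real T * (\<Sum>s<T. \<Sum>c\<in>S. w c * D c s)"
    by (subst sum.swap) (simp add: sum_distrib_left mult_ac)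
  also have "\<dots> \<le> real T * (\<Sum>s<T. 4 * \<delta>)"
    by (intro mult_left_mono sum_mono query) auto
  finally show ?thesis by (simp add: power2_eq_square mult_ac)
qed

lemma measurement_sq_norm_le:
  assumes "measurement d C M" "finite C" "c \<in> C" "v \<in> carrier_vec d"
  shows "sq_norm (M c *\<^sub>v v) \<le> sq_norm v"
proof -
  have "M c' *\<^sub>v v \<in> carrier_vec d" if "c' \<in> C" for c'
    using assms that by (auto simp: measurement_def intro!: mult_mat_vec_carrier)
  hence "sq_norm (M c *\<^sub>v v) \<le> (\<Sum>c\<in>C. sq_norm (M c *\<^sub>v v))"
    using assms sq_norm_nonneg by (intro member_le_sum) auto
  thus ?thesis using measurement_sum_sq_norm assms by simp
qed

text \<open>A state near the final state of a concept gives that outcome with probability above \<open>1/2\<close>,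
  so no state is near the final states of two concepts.\<close>

lemma near_final_state_unique:
  assumes M: "measurement d C M" and C: "finite C" "c \<in> C" "c' \<in> C"
    and car: "u \<in> carrier_vec d" "u' \<in> carrier_vec d" "v \<in> carrier_vec d"
    and v: "sq_norm v = 1"
    and succ: "sq_norm (M c *\<^sub>v u) \<ge> 2/3" "sq_norm (M c' *\<^sub>v u') \<ge> 2/3"
    and near: "sq_norm (u - v) < 1/100" "sq_norm (u' - v) < 1/100"
  shows "c = c'"
proof (rule ccontr)
  assume ne: "c \<noteq> c'"
  have half: "sq_norm (M a *\<^sub>v v) > 1/2"
    if a: "a \<in> C" "x \<in> carrier_vec d" "sq_norm (M a *\<^sub>v x) \<ge> 2/3" "sq_norm (x - v) < 1/100" for a x
  proof -
    have Ma: "M a \<in> carrier_mat d d" using M a(1) by (simp add: measurement_def)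
    have car': "M a *\<^sub>v y \<in> carrier_vec d" if "y \<in> carrier_vec d" for y
      using Ma that by (rule mult_mat_vec_carrier)
    have "M a *\<^sub>v x = M a *\<^sub>v v + M a *\<^sub>v (x - v)"
      unfolding mult_minus_distrib_mat_vec[OF Ma a(2) car(3)]
      using car'[OF a(2)] car'[OF car(3)] by (intro eq_vecI) auto
    hence "sqrt (sq_norm (M a *\<^sub>v x)) \<le> sqrt (sq_norm (M a *\<^sub>v v)) + sqrt (sq_norm (M a *\<^sub>v (x - v)))"
      using sq_norm_add_le car' car(3) a(2) by (metis minus_carrier_vec)
    moreover have "sqrt (sq_norm (M a *\<^sub>v (x - v))) \<le> 1/10"
    proof (rule real_le_lsqrt)
      show "sq_norm (M a *\<^sub>v (x - v)) \<le> (1/10)\<^sup>2"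
        using measurement_sq_norm_le[OF M C(1) a(1), of "x - v"] a car
        by (auto simp: power2_eq_square)
    qed simp
    \<comment> \<open>0.816 lies just below sqrt (2/3). Subtracting 1/10 leaves 0.716, whose square
      is still above 1/2.\<close>
    moreover have "sqrt (sq_norm (M a *\<^sub>v x)) \<ge> 0.816"
      using a(3) by (intro real_le_rsqrt) (simp add: power2_eq_square)
    ultimately have "sqrt (sq_norm (M a *\<^sub>v v)) \<ge> 0.716" by simp
    hence "(0.716 :: real)\<^sup>2 \<le> (sqrt (sq_norm (M a *\<^sub>v v)))\<^sup>2" by (intro power_mono) auto
    thus ?thesis using sq_norm_nonneg[OF car'[OF car(3)]] by (simp add: power2_eq_square)
  qed
  have "(\<Sum>a\<in>{c, c'}. sq_norm (M a *\<^sub>v v)) \<le> (\<Sum>a\<in>C. sq_norm (M a *\<^sub>v v))"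
  proof (rule sum_mono2)
    fix a assume "a \<in> C - {c, c'}"
    hence "M a *\<^sub>v v \<in> carrier_vec d" using M car by (auto simp: measurement_def intro!: mult_mat_vec_carrier)
    thus "sq_norm (M a *\<^sub>v v) \<ge> 0" by (rule sq_norm_nonneg)
  qed (use C in auto)
  also have "\<dots> = 1" using measurement_sum_sq_norm[OF M car(3)] v by simp
  finally show False
    using ne half[OF C(2) car(1) succ(1) near(1)] half[OF C(3) car(2) succ(2) near(2)] by simp
qed

text \<open>If no position is balanced, each has a light answer \<open>g x\<close>; flipping it
  gives the majority function \<open>m\<close>. The concepts then end, on weighted average, close to
  the final state of \<open>m\<close>, but only one concept can be near it, so that concept carries
  almost all the weight.\<close>

lemma quantum_learner_balanced_query:
  fixes w :: "concept \<Rightarrow> real"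
  assumes C: "concept_class N C" and L: "quantum_learner N C T W \<psi> U M"
    and S: "S \<subseteq> C" "S \<noteq> {}" and w: "\<And>c. c \<in> S \<Longrightarrow> w c \<ge> 0"
  obtains (heavy) a where "a \<in> S" "w a \<ge> 5/6 * sum w S"
  | (balanced) x where "x \<in> {1..N}"
      "\<And>b. b \<in> {-1, 1} \<Longrightarrow> sum w {c \<in> S. c x = b} * (50 * real T)\<^sup>2 \<ge> sum w S"
proof (cases "\<exists>x\<in>{1..N}. \<forall>b\<in>{-1, 1}. sum w {c \<in> S. c x = b} * (50 * real T)\<^sup>2 \<ge> sum w S")
  case True
  then obtain x where "x \<in> {1..N}"
      "\<forall>b\<in>{-1, 1}. sum w {c \<in> S. c x = b} * (50 * real T)\<^sup>2 \<ge> sum w S" by blast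
  with balanced show ?thesis by blast
next
  case False
  let ?q = "\<lambda>c. quantum_state N W \<psi> U c T"
  have CE: "C \<subseteq> {1..N} \<rightarrow>\<^sub>E {-1, 1}" using C by (simp add: concept_class_def)
  have finC: "finite C" using C by (rule concept_class_finite)
  have finS: "finite S" using S(1) finC by (rule finite_subset)
  have L': "\<psi> \<in> carrier_vec (2 * N * W)" "sq_norm \<psi> = 1"
    "\<And>t. t \<le> T \<Longrightarrow> unitary_mat (2 * N * W) (U t)" "measurement (2 * N * W) C M"
    "\<And>c. c \<in> C \<Longrightarrow> sq_norm (M c *\<^sub>v ?q c) \<ge> 2/3"
    using L by (simp_all add: quantum_learner_def)
  have "\<forall>x\<in>{1..N}. \<exists>b. b \<in> {-1, 1} \<and> sum w {c \<in> S. c x = b} * (50 * real T)\<^sup>2 < sum w S"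
  proof
    fix x assume "x \<in> {1..N}"
    with False obtain b where "b \<in> {-1, 1}"
      "\<not> sum w S \<le> sum w {c \<in> S. c x = b} * (50 * real T)\<^sup>2" by blast
    thus "\<exists>b. b \<in> {-1, 1} \<and> sum w {c \<in> S. c x = b} * (50 * real T)\<^sup>2 < sum w S"
      unfolding not_le by blast
  qed
  then obtain g where "\<forall>x\<in>{1..N}. g x \<in> {-1, 1} \<and>
      sum w {c \<in> S. c x = g x} * (50 * real T)\<^sup>2 < sum w S"
    by (rule bchoice[THEN exE])
  hence g: "g x \<in> {-1, 1}" "sum w {c \<in> S. c x = g x} * (50 * real T)\<^sup>2 < sum w S"
    if "x \<in> {1..N}" for x
    using that by (auto simp del: atLeastAtMost_iff)
  define m where "m = (\<lambda>x\<in>{1..N}. - g x)"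
  have m: "m \<in> {1..N} \<rightarrow>\<^sub>E {-1, 1}"
    unfolding m_def
  proof (rule restrict_PiE_iff[THEN iffD2], rule ballI)
    fix x assume "x \<in> {1..N}"
    from g(1)[OF this] show "- g x \<in> {-1, 1}" by auto
  qed
  have minority: "{c \<in> S. c x \<noteq> m x} = {c \<in> S. c x = g x}" if x: "x \<in> {1..N}" for x
  proof (rule Collect_cong)
    fix c
    show "(c \<in> S \<and> c x \<noteq> m x) = (c \<in> S \<and> c x = g x)"
    proof (cases "c \<in> S")
      case True
      hence "c \<in> {1..N} \<rightarrow>\<^sub>E {-1, 1}" using S(1) CE by blast
      hence "c x \<in> {-1, 1}" using x by (rule PiE_mem)
      thus ?thesis using g(1)[OF x] x True by (auto simp: m_def)
    qed simp
  qed
  have mcar: "?q c \<in> carrier_vec (2 * N * W)" for c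
    using L' by (intro quantum_state_carrier) auto
  have mnorm: "sq_norm (?q m) = 1"
    using L' m by (intro sq_norm_quantum_state) auto
  have w0: "sum w S \<ge> 0" using w by (rule sum_nonneg)
  have close: "(\<Sum>c\<in>S. w c * sq_norm (?q c - ?q m)) \<le> sum w S / 625"
  \<comment> \<open>In general 1/625 is 4 T^2 / (50 T)^2. With no queries that quotient is
    meaningless, but the factor \<open>T\<close> makes the bound zero for any \<delta>, so the
    trivial choice \<open>sum w S\<close> serves.\<close>
  proof (cases "T = 0")
    case True
    have "(\<Sum>c\<in>S. w c * sq_norm (?q c - ?q m)) \<le> 4 * (real T)\<^sup>2 * sum w S"
    proof (rule sum_weighted_quantum_state_diff[OF L'(1,2,3) finS _ m w])
      show "sum w {c \<in> S. c x \<noteq> m x} \<le> sum w S" for x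
        using finS w by (intro sum_mono2) auto
    qed (use S CE in auto)
    thus ?thesis using True w0 by simp
  next
    case False
    have "(\<Sum>c\<in>S. w c * sq_norm (?q c - ?q m)) \<le> 4 * (real T)\<^sup>2 * (sum w S / (50 * real T)\<^sup>2)"
    proof (rule sum_weighted_quantum_state_diff[OF L'(1,2,3) finS _ m w])
      fix x assume x: "x \<in> {1..N}"
      show "sum w {c \<in> S. c x \<noteq> m x} \<le> sum w S / (50 * real T)\<^sup>2"
        using g(2)[OF x] False unfolding minority[OF x] by (simp add: pos_le_divide_eq)
    qed (use S CE in auto)
    also have "\<dots> = sum w S / 625" using False by (simp add: power_mult_distrib)
    finally show ?thesis .
  qed
  \<comment> \<open>If no concept is near, the second property is vacuous and any element of
    \<open>S\<close> will do.\<close>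
  obtain a where a: "a \<in> S" "\<And>c. c \<in> S \<Longrightarrow> sq_norm (?q c - ?q m) < 1/100 \<Longrightarrow> c = a"
  proof (cases "\<exists>a\<in>S. sq_norm (?q a - ?q m) < 1/100")
    case True
    then obtain a where a: "a \<in> S" "sq_norm (?q a - ?q m) < 1/100" by blast
    show ?thesis
    proof (rule that[OF a(1)])
      fix c assume c: "c \<in> S" "sq_norm (?q c - ?q m) < 1/100"
      show "c = a"
        by (rule near_final_state_unique[OF L'(4) finC _ _ mcar mcar mcar mnorm L'(5) L'(5)])
           (use a c S(1) in auto)
    qed
  next
    case False
    with S(2) that show ?thesis by blast
  qed
  \<comment> \<open>All concepts other than \<open>a\<close> have squared distance at least 1/100,
    so together they weigh at most 100/625 = 4/25 of the total, which is below 1/6.\<close>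
  have "(\<Sum>c\<in>S - {a}. w c * (1/100)) \<le> (\<Sum>c\<in>S - {a}. w c * sq_norm (?q c - ?q m))"
  proof (intro sum_mono mult_left_mono)
    fix c assume "c \<in> S - {a}"
    thus "1/100 \<le> sq_norm (?q c - ?q m)" "0 \<le> w c" using a(2)[of c] w by force+
  qed
  also have "\<dots> \<le> (\<Sum>c\<in>S. w c * sq_norm (?q c - ?q m))"
  proof (rule sum_mono2[OF finS])
    fix c assume "c \<in> S - (S - {a})"
    hence "w c \<ge> 0" using w by simp
    moreover have "sq_norm (?q c - ?q m) \<ge> 0"
      by (rule sq_norm_nonneg[of _ "2 * N * W"]) (use mcar in simp)
    ultimately show "0 \<le> w c * sq_norm (?q c - ?q m)" by simp
  qed auto
  finally have "sum w (S - {a}) / 100 \<le> sum w S / 625"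
    using close by (simp add: sum_divide_distrib)
  moreover have "sum w S = w a + sum w (S - {a})" using a(1) finS by (rule sum.remove[rotated])
  ultimately have "w a \<ge> 5/6 * sum w S" using w0 by simp
  with a(1) heavy show ?thesis by blast
qed


section \<open>Decision trees from entropy\<close>

text \<open>Shannon entropy in nats of the normalized weights, multiplied by the total weight.
  Leaving it unnormalized makes the entropies of the two branches of a query simply add.\<close>

definition weight_entropy :: "('a \<Rightarrow> real) \<Rightarrow> 'a set \<Rightarrow> real" where
  "weight_entropy w S = (\<Sum>c\<in>S. w c * ln (sum w S / w c))"

lemma weight_entropy_nonneg:
  assumes "finite S" "\<And>c. c \<in> S \<Longrightarrow> w c > 0"
  shows "weight_entropy w S \<ge> 0"
  unfolding weight_entropy_def
proof (rule sum_nonneg)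
  fix c assume c: "c \<in> S"
  have "w c \<le> sum w S" using assms c by (intro member_le_sum) (auto intro: less_imp_le)
  thus "w c * ln (sum w S / w c) \<ge> 0" using assms(2)[OF c] by simp
qed

text \<open>Gibbs' inequality against the uniform distribution: ln y \<le> y - 1 at
  \<open>y = W / (n * w c)\<close>, where the correction terms \<open>W / n - w c\<close> cancel in
  the sum.\<close>

lemma weight_entropy_le_ln_card:
  assumes fin: "finite S" and w: "\<And>c. c \<in> S \<Longrightarrow> w c > 0"
  shows "weight_entropy w S \<le> sum w S * ln (real (card S))"
proof (cases "S = {}")
  case True
  thus ?thesis by (simp add: weight_entropy_def)
next
  case False
  define n where "n = real (card S)"
  define W where "W = sum w S"
  have n: "n > 0" using fin False by (simp add: n_def card_gt_0_iff)
  have W: "W > 0" unfolding W_def using fin False w by (rule sum_pos)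
  have "w c * ln (W / w c) \<le> w c * ln n + W / n - w c" if c: "c \<in> S" for c
  proof -
    have wc: "w c > 0" using w c .
    have "ln (W / w c) = ln n + ln (W / (n * w c))"
      using wc n W by (simp add: ln_div ln_mult)
    also have "\<dots> \<le> ln n + (W / (n * w c) - 1)"
      using wc n W by (intro add_left_mono ln_le_minus_one) simp
    finally have "w c * ln (W / w c) \<le> w c * (ln n + (W / (n * w c) - 1))"
      using wc by (intro mult_left_mono) auto
    also have "\<dots> = w c * ln n + W / n - w c" using wc n by (simp add: field_simps)
    finally show ?thesis .
  qed
  hence "weight_entropy w S \<le> (\<Sum>c\<in>S. w c * ln n + W / n - w c)"
    unfolding weight_entropy_def W_def[symmetric] by (rule sum_mono)
  also have "\<dots> = W * ln n"
    using n by (simp add: sum.distrib sum_subtractf sum_distrib_right[symmetric] W_def n_def)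
  finally show ?thesis by (simp add: W_def n_def)
qed

text \<open>Chain rule for entropy: on a part \<open>X\<close>, the quotient \<open>W / w c\<close>
  factors through \<open>sum w X\<close>.\<close>

lemma weight_entropy_split:
  assumes fin: "finite A" "finite B" and disj: "A \<inter> B = {}" and ne: "A \<noteq> {}" "B \<noteq> {}"
    and w: "\<And>c. c \<in> A \<union> B \<Longrightarrow> w c > 0"
  shows "weight_entropy w (A \<union> B) = weight_entropy w A + weight_entropy w B +
    sum w A * ln (sum w (A \<union> B) / sum w A) + sum w B * ln (sum w (A \<union> B) / sum w B)"
proof -
  define W where "W = sum w (A \<union> B)"
  have W: "W > 0" unfolding W_def by (rule sum_pos) (use fin ne w in auto)
  have part: "(\<Sum>c\<in>X. w c * ln (W / w c)) = weight_entropy w X + sum w X * ln (W / sum w X)"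
    if X: "X \<subseteq> A \<union> B" "X \<noteq> {}" for X
  proof -
    have "finite X" by (rule finite_subset[OF X(1)]) (use fin in simp)
    hence WX: "sum w X > 0" by (rule sum_pos) (use X w in auto)
    have "w c * ln (W / w c) = w c * ln (sum w X / w c) + w c * ln (W / sum w X)"
      if "c \<in> X" for c
      using WX W w[of c] X that by (auto simp: ln_div algebra_simps)
    thus ?thesis by (simp add: weight_entropy_def sum.distrib sum_distrib_right)
  qed
  show ?thesis
    using part[of A] part[of B] ne fin disj
    by (simp add: weight_entropy_def[of w "A \<union> B"] W_def[symmetric] sum.union_disjoint)
qed

text \<open>\<open>a * ln (W / a)\<close> is not monotone in \<open>a\<close> up to
  \<open>W / 2\<close>, hence two cases. For \<open>a\<close> at most \<open>W / m\<close>, both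
  factors are bounded directly, by \<open>W / m\<^sup>2\<close> and \<open>ln m\<close>. For larger
  \<open>a\<close>, the logarithm is still at least ln 2 \<ge> 1/2, and ln m \<le> m shows that this
  is enough.\<close>

lemma information_of_minority:
  fixes a W m :: real
  assumes a: "0 < a" "a \<le> W / 2" and m: "m \<ge> 1" and am: "a * m\<^sup>2 \<ge> W"
  shows "a * ln (W / a) \<ge> W * (ln m / (2 * m\<^sup>2))"
proof (cases "a \<le> W / m")
  case True
  have "W > 0" using a by simp
  have "W * (ln m / (2 * m\<^sup>2)) \<le> (W / m\<^sup>2) * ln m"
    using m \<open>W > 0\<close> by (simp add: field_simps)
  also have "\<dots> \<le> a * ln (W / a)"
  proof (rule mult_mono)
    show "W / m\<^sup>2 \<le> a" using am m by (simp add: field_simps)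
    show "ln m \<le> ln (W / a)" using True a m by (simp add: field_simps)
  qed (use a m in auto)
  finally show ?thesis .
next
  case False
  have "W > 0" using a by simp
  have ln2: "ln 2 \<ge> (1/2 :: real)" using ln2_ge_two_thirds by simp
  have "ln m \<le> m" using ln_bound m by simp
  hence "W * (ln m / (2 * m\<^sup>2)) \<le> W * (m / (2 * m\<^sup>2))"
    using \<open>W > 0\<close> m by (intro mult_left_mono divide_right_mono) auto
  also have "\<dots> = (W / m) * (1/2)" using m by (simp add: power2_eq_square)
  also have "\<dots> \<le> a * ln (W / a)"
  proof (rule mult_mono)
    have "ln 2 \<le> ln (W / a)" using a by (simp add: field_simps)
    thus "1/2 \<le> ln (W / a)" using ln2 by simp
  qed (use False a in auto)
  finally show ?thesis .
qed

text \<open>In the conclusion \<open>U\<close> is the weight still unresolved after \<open>n\<close> queries and \<open>A\<close> the weighted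
  number of queries made; every query gains \<open>ln m / (2 * m\<^sup>2)\<close> of entropy on average.\<close>

lemma entropy_decision_tree:
  fixes w :: "concept \<Rightarrow> real"
  assumes C: "finite C" "C \<subseteq> {1..N} \<rightarrow>\<^sub>E {-1, 1}" and m: "m \<ge> 1"
    and w: "\<And>c. c \<in> C \<Longrightarrow> w c > 0"
    and query: "\<And>S. S \<subseteq> C \<Longrightarrow> S \<noteq> {} \<Longrightarrow> (\<exists>a\<in>S. w a \<ge> 5/6 * sum w S) \<or>
      (\<exists>x\<in>{1..N}. \<forall>b\<in>{-1, 1}. sum w {c \<in> S. c x = b} * m\<^sup>2 \<ge> sum w S)"
    and S: "S \<subseteq> C" "S \<noteq> {}"
  shows "\<exists>t U A. well_formed_tree N C t \<and> depth t \<le> n \<and>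
    sum w {c \<in> S. run_tree t c \<noteq> c} \<le> sum w S / 6 + U \<and> U \<le> sum w S \<and>
    real n * U \<le> A \<and> ln m / (2 * m\<^sup>2) * A \<le> weight_entropy w S"
  using S
proof (induction n arbitrary: S)
  case 0
  \<comment> \<open>With no queries left, all weight counts as unresolved: \<open>U\<close> is
    \<open>sum w S\<close> and \<open>A\<close> is 0.\<close>
  obtain a where a: "a \<in> S" using 0 by blast
  have fin: "finite S" using 0 C(1) finite_subset by blast
  have pos: "w c > 0" if "c \<in> S" for c using that 0 w by blast
  have "sum w {c \<in> S. run_tree (Output a) c \<noteq> c} \<le> sum w S"
    using fin pos by (intro sum_mono2) (auto intro: less_imp_le)
  moreover have "sum w S \<ge> 0" using pos by (intro sum_nonneg less_imp_le)
  ultimately show ?case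
    using a 0 weight_entropy_nonneg[of S w] fin pos
    by (intro exI[of _ "Output a"] exI[of _ "sum w S"] exI[of _ 0]) auto
next
  case (Suc n)
  define h where "h = ln m / (2 * m\<^sup>2)"
  have fin: "finite S" using Suc.prems C(1) finite_subset by blast
  have pos: "w c > 0" if "c \<in> S" for c using that Suc.prems w by blast
  have ent0: "weight_entropy w S \<ge> 0" using fin pos by (rule weight_entropy_nonneg)
  have W: "sum w S > 0" using fin Suc.prems(2) pos by (rule sum_pos)
  from query[OF Suc.prems] show ?case
  proof
    assume "\<exists>a\<in>S. w a \<ge> 5/6 * sum w S"
    then obtain a where a: "a \<in> S" "w a \<ge> 5/6 * sum w S" by blast
    \<comment> \<open>Stopping at a heavy concept puts its error into the allowance
      \<open>sum w S / 6\<close>, so nothing is unresolved and no query is paid for.\<close>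
    have "{c \<in> S. run_tree (Output a) c \<noteq> c} = S - {a}" by auto
    hence "sum w {c \<in> S. run_tree (Output a) c \<noteq> c} \<le> sum w S / 6"
      using a sum.remove[OF fin a(1), of w] by simp
    thus ?thesis using a Suc.prems W ent0
      by (intro exI[of _ "Output a"] exI[of _ 0] exI[of _ 0]) auto
  next
    assume "\<exists>x\<in>{1..N}. \<forall>b\<in>{-1, 1}. sum w {c \<in> S. c x = b} * m\<^sup>2 \<ge> sum w S"
    then obtain x where x: "x \<in> {1..N}"
      and bal: "\<And>b. b \<in> {-1, 1} \<Longrightarrow> sum w {c \<in> S. c x = b} * m\<^sup>2 \<ge> sum w S" by blast
    define L where "L = {c \<in> S. c x = -1}"
    define R where "R = {c \<in> S. c x = 1}"
    have cx: "c x = -1 \<or> c x = 1" if "c \<in> S" for c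
    proof -
      have "c \<in> {1..N} \<rightarrow>\<^sub>E {-1, 1}" using that Suc.prems C(2) by blast
      hence "c x \<in> {-1, 1}" using x by (rule PiE_mem)
      thus ?thesis by auto
    qed
    have LR: "L \<union> R = S" "L \<inter> R = {}" "finite L" "finite R" "L \<subseteq> C" "R \<subseteq> C"
      using cx fin Suc.prems by (auto simp: L_def R_def)
    have balL: "sum w L * m\<^sup>2 \<ge> sum w S" and balR: "sum w R * m\<^sup>2 \<ge> sum w S"
      using bal[of "-1"] bal[of 1] by (simp_all add: L_def R_def)
    have ne: "L \<noteq> {}" "R \<noteq> {}" using balL balR W by auto
    have WL: "sum w L > 0" and WR: "sum w R > 0"
      using LR ne pos by (auto intro!: sum_pos)
    have Wsum: "sum w S = sum w L + sum w R"
      using LR by (metis sum.union_disjoint)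
    \<comment> \<open>The branch with at most half the weight already yields the gain; the other
      term is nonnegative.\<close>
    have gain: "sum w S * h \<le> sum w L * ln (sum w S / sum w L) + sum w R * ln (sum w S / sum w R)"
    proof -
      have nonneg: "0 \<le> sum w L * ln (sum w S / sum w L)" "0 \<le> sum w R * ln (sum w S / sum w R)"
        using WL WR Wsum by auto
      show ?thesis
      proof (cases "sum w L \<le> sum w S / 2")
        case True
        thus ?thesis using information_of_minority[OF WL True m balL] nonneg by (simp add: h_def)
      next
        case False
        hence "sum w R \<le> sum w S / 2" using Wsum by simp
        thus ?thesis using information_of_minority[OF WR _ m balR] nonneg by (simp add: h_def)
      qed
    qed
    from Suc.IH[OF LR(5) ne(1)] obtain tl Ul Al where l: "well_formed_tree N C tl" "depth tl \<le> n"
      "sum w {c \<in> L. run_tree tl c \<noteq> c} \<le> sum w L / 6 + Ul" "Ul \<le> sum w L"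
      "real n * Ul \<le> Al" "h * Al \<le> weight_entropy w L" unfolding h_def by blast
    from Suc.IH[OF LR(6) ne(2)] obtain tr Ur Ar where r: "well_formed_tree N C tr" "depth tr \<le> n"
      "sum w {c \<in> R. run_tree tr c \<noteq> c} \<le> sum w R / 6 + Ur" "Ur \<le> sum w R"
      "real n * Ur \<le> Ar" "h * Ar \<le> weight_entropy w R" unfolding h_def by blast
    have "{c \<in> S. run_tree (Query x tl tr) c \<noteq> c} =
        {c \<in> L. run_tree tl c \<noteq> c} \<union> {c \<in> R. run_tree tr c \<noteq> c}"
      using cx by (auto simp: L_def R_def)
    moreover have "sum w ({c \<in> L. run_tree tl c \<noteq> c} \<union> {c \<in> R. run_tree tr c \<noteq> c}) =
        sum w {c \<in> L. run_tree tl c \<noteq> c} + sum w {c \<in> R. run_tree tr c \<noteq> c}"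
      using LR by (intro sum.union_disjoint) auto
    ultimately have "sum w {c \<in> S. run_tree (Query x tl tr) c \<noteq> c} =
        sum w {c \<in> L. run_tree tl c \<noteq> c} + sum w {c \<in> R. run_tree tr c \<noteq> c}"
      by (simp only:)
    also have "\<dots> \<le> (sum w L / 6 + Ul) + (sum w R / 6 + Ur)"
      using l(3) r(3) by (rule add_mono)
    also have "\<dots> = sum w S / 6 + (Ul + Ur)"
      by (simp add: Wsum add_divide_distrib)
    finally have "sum w {c \<in> S. run_tree (Query x tl tr) c \<noteq> c} \<le> sum w S / 6 + (Ul + Ur)" .
    moreover have "well_formed_tree N C (Query x tl tr) \<and> depth (Query x tl tr) \<le> Suc n"
      using l r x by simp
    moreover have "Ul + Ur \<le> sum w S" using l r Wsum by simp
    \<comment> \<open>The root query is asked for the whole weight \<open>sum w S\<close>. It pays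
      for the extra summand \<open>Ul + Ur\<close>, which is why the induction carries the bound of
      \<open>U\<close> by the weight.\<close>
    moreover have "real (Suc n) * (Ul + Ur) \<le> sum w S + Al + Ar"
      using l(4,5) r(4,5) Wsum by (simp add: algebra_simps)
    moreover have "h * (sum w S + Al + Ar) \<le> weight_entropy w S"
      using weight_entropy_split[of L R w] LR ne pos gain l(6) r(6) by (simp add: algebra_simps)
    ultimately show ?thesis unfolding h_def by blast
  qed
qed

text \<open>A Markov-type bound: unresolved weight \<open>U\<close> costs at least
  \<open>n * U\<close> queries, and the total entropy pays for at most
  \<open>sum w C * ln (card C) / h\<close>. The 12 in the choice of \<open>n\<close> makes
  \<open>U\<close> at most a twelfth of the weight, and 1/6 + 1/12 = 1/4.\<close>

lemma accurate_decision_tree: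
  fixes w :: "concept \<Rightarrow> real"
  assumes C: "finite C" "C \<subseteq> {1..N} \<rightarrow>\<^sub>E {-1, 1}" "card C \<ge> 2" and m: "m > 1"
    and w: "\<And>c. c \<in> C \<Longrightarrow> w c > 0"
    and query: "\<And>S. S \<subseteq> C \<Longrightarrow> S \<noteq> {} \<Longrightarrow> (\<exists>a\<in>S. w a \<ge> 5/6 * sum w S) \<or>
      (\<exists>x\<in>{1..N}. \<forall>b\<in>{-1, 1}. sum w {c \<in> S. c x = b} * m\<^sup>2 \<ge> sum w S)"
    and n: "real n * (ln m / (2 * m\<^sup>2)) \<ge> 12 * ln (real (card C))"
  shows "\<exists>t. well_formed_tree N C t \<and> depth t \<le> n \<and> sum w {c \<in> C. run_tree t c \<noteq> c} \<le> sum w C / 4"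
proof -
  define h where "h = ln m / (2 * m\<^sup>2)"
  have h: "h > 0" using m by (simp add: h_def)
  have "C \<noteq> {}" using C(3) by auto
  then obtain t U A where t: "well_formed_tree N C t" "depth t \<le> n"
    "sum w {c \<in> C. run_tree t c \<noteq> c} \<le> sum w C / 6 + U"
    and U: "real n * U \<le> A" "h * A \<le> weight_entropy w C"
    using entropy_decision_tree[OF C(1,2) less_imp_le[OF m] w query subset_refl, of n] unfolding h_def by blast
  have "sum w C / 12 \<ge> U"
  proof (rule ccontr)
    assume "\<not> ?thesis"
    hence less: "U > sum w C / 12" by simp
    have W: "sum w C \<ge> 0" using w by (intro sum_nonneg less_imp_le)
    have lnC: "ln (real (card C)) > 0" using C(3) by simp
    have "sum w C * ln (real (card C)) < 12 * ln (real (card C)) * U"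
      using mult_strict_left_mono[OF less lnC] by (simp add: field_simps)
    also have "\<dots> \<le> (real n * h) * U"
      using n less W by (intro mult_right_mono) (auto simp: h_def)
    also have "\<dots> \<le> h * A" using mult_left_mono[OF U(1), of h] h by (simp add: mult_ac)
    also have "\<dots> \<le> sum w C * ln (real (card C))"
      using U(2) weight_entropy_le_ln_card[of C w, OF C(1) w] by simp
    finally show False by simp
  qed
  with t show ?thesis by (intro exI[of _ t]) auto
qed

section \<open>From trees with small average error to one randomized learner\<close>

text \<open>Each round takes a tree that is good for the current weights and multiplies the weight
  of every concept it identifies by 3/4. The total shrinks at least by 3/4 + 1/4 * 1/4 = 13/16 per
  round, so no concept can keep a large weight: each is identified in more than 2/3 of the rounds. A
  uniformly random round then gives the distribution.\<close>

lemma multiplicative_weights: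
  fixes P :: "'b \<Rightarrow> 'a \<Rightarrow> bool"
  assumes C: "finite C" "C \<noteq> {}"
    and weak: "\<And>w :: 'a \<Rightarrow> real. (\<And>c. c \<in> C \<Longrightarrow> w c > 0) \<Longrightarrow>
      \<exists>t\<in>X. sum w {c \<in> C. \<not> P t c} \<le> sum w C / 4"
  shows "\<exists>D. set_pmf D \<subseteq> X \<and> (\<forall>c\<in>C. measure_pmf.prob D {t. \<not> P t c} \<le> 1/3)"
proof -
  have "\<forall>w :: 'a \<Rightarrow> real. \<exists>t. (\<forall>c\<in>C. w c > 0) \<longrightarrow>
      t \<in> X \<and> sum w {c \<in> C. \<not> P t c} \<le> sum w C / 4"
    using weak by blast
  then obtain pick where pick: "\<And>w :: 'a \<Rightarrow> real. \<forall>c\<in>C. w c > 0 \<Longrightarrow>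
      pick w \<in> X \<and> sum w {c \<in> C. \<not> P (pick w) c} \<le> sum w C / 4"
    by metis
  define wt :: "nat \<Rightarrow> 'a \<Rightarrow> real" where
    "wt = rec_nat (\<lambda>_. 1) (\<lambda>_ w c. w c * (if P (pick w) c then 3/4 else 1))"
  define t where "t k = pick (wt k)" for k
  have wt0: "wt 0 c = 1" and wtS: "wt (Suc k) c = wt k c * (if P (t k) c then 3/4 else 1)" for k c
    by (simp_all add: wt_def t_def)
  have wt_eq: "wt k c = (3/4) ^ card {j. j < k \<and> P (t j) c}" for k c
  proof (induction k)
    case (Suc k)
    have "{j. j < Suc k \<and> P (t j) c} = {j. j < k \<and> P (t j) c} \<union> (if P (t k) c then {k} else {})"
      by (auto simp: less_Suc_eq)
    thus ?case using Suc by (simp add: wtS)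
  qed (simp add: wt0)
  have pos: "wt k c > 0" for k c by (simp add: wt_eq)
  have tX: "t k \<in> X" and terr: "sum (wt k) {c \<in> C. \<not> P (t k) c} \<le> sum (wt k) C / 4" for k
    using pick[of "wt k"] pos by (simp_all add: t_def)
  have total: "sum (wt k) C \<le> real (card C) * (13/16) ^ k" for k
  proof (induction k)
    case (Suc k)
    have "sum (wt (Suc k)) C = (\<Sum>c\<in>C. 3/4 * wt k c + (if \<not> P (t k) c then wt k c / 4 else 0))"
      by (intro sum.cong refl) (simp add: wtS)
    also have "\<dots> = 3/4 * sum (wt k) C + sum (wt k) {c \<in> C. \<not> P (t k) c} / 4"
      by (auto simp: sum.distrib sum_distrib_left sum.inter_filter[OF C(1)] sum_divide_distrib
          intro!: sum.cong)
    also have "\<dots> \<le> 13/16 * sum (wt k) C" using terr[of k] by simp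
    also have "\<dots> \<le> 13/16 * (real (card C) * (13/16) ^ k)" using Suc by simp
    finally show ?case by simp
  qed (simp add: wt0)
  \<comment> \<open>2304/2197 is (3/4)^2 / (13/16)^3. That it exceeds 1 is what lets error 1/4 on
    average become error 1/3 for every concept.\<close>
  obtain K where K: "(2304/2197 :: real) ^ K > real (card C) ^ 3"
    using real_arch_pow[of "2304/2197"] by auto
  have "card C \<ge> 1" using C by (simp add: Suc_le_eq card_gt_0_iff)
  hence "real (card C) ^ 3 \<ge> 1" by (intro one_le_power) simp
  hence K0: "K > 0" using K by (cases "K = 0") auto
  have most: "3 * card {j. j < K \<and> P (t j) c} > 2 * K" if c: "c \<in> C" for c
  proof (rule ccontr)
    define s where "s = card {j. j < K \<and> P (t j) c}"
    assume "\<not> ?thesis"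
    hence s: "3 * s \<le> 2 * K" by (simp add: s_def)
    \<comment> \<open>Weights are compared after cubing, which avoids the fractional exponent
      \<open>2 * K / 3\<close>.\<close>
    have "(9/16 :: real) ^ K = (3/4) ^ (2 * K)" by (simp add: power_mult power2_eq_square)
    also have "\<dots> \<le> (3/4) ^ (3 * s)" by (rule power_decreasing[OF s]) auto
    also have "\<dots> = wt K c ^ 3" by (simp add: wt_eq s_def power_mult[symmetric] mult.commute)
    also have "\<dots> \<le> (real (card C) * (13/16) ^ K) ^ 3"
    proof (rule power_mono)
      have "wt K c \<le> sum (wt K) C"
        using C(1) c pos by (intro member_le_sum) (auto intro: less_imp_le)
      thus "wt K c \<le> real (card C) * (13/16) ^ K" using total[of K] by simp
    qed (use pos[of K c] in simp)
    also have "\<dots> = real (card C) ^ 3 * (2197/4096) ^ K"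
      by (simp add: power_mult_distrib power_mult[symmetric] mult.commute[of K])
         (simp add: power_mult power3_eq_cube)
    also have "\<dots> < (2304/2197) ^ K * (2197/4096) ^ K"
      using K by (intro mult_strict_right_mono) auto
    also have "\<dots> = (9/16) ^ K" by (simp flip: power_mult_distrib)
    finally show False by simp
  qed
  define D where "D = map_pmf t (pmf_of_set {..<K})"
  have ne: "{..<K} \<noteq> {}" using K0 by auto
  show ?thesis
  proof (intro exI[of _ D] conjI ballI)
    show "set_pmf D \<subseteq> X" using ne tX by (auto simp: D_def)
    fix c assume c: "c \<in> C"
    have "{..<K} \<inter> {j. \<not> P (t j) c} = {..<K} - {j. j < K \<and> P (t j) c}" by auto
    hence "card ({..<K} \<inter> {j. \<not> P (t j) c}) = K - card {j. j < K \<and> P (t j) c}"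
      by (simp add: card_Diff_subset subset_eq)
    hence "3 * card ({..<K} \<inter> {j. \<not> P (t j) c}) \<le> K" using most[OF c] by linarith
    hence "3 * real (card ({..<K} \<inter> {j. \<not> P (t j) c})) \<le> real K" by linarith
    moreover have prob: "measure_pmf.prob D {t. \<not> P t c} = real (card ({..<K} \<inter> {j. \<not> P (t j) c})) / real K"
      using ne by (simp add: D_def measure_map_pmf measure_pmf_of_set vimage_def)
    ultimately show "measure_pmf.prob D {t. \<not> P t c} \<le> 1/3"
      unfolding prob using K0 by (simp add: pos_divide_le_eq)
  qed
qed


section \<open>The polynomial method\<close>

text \<open>Gaussian elimination: an equation with a nonzero coefficient at \<open>a\<close> is
  subtracted from the others to remove that unknown, and the value at \<open>a\<close> is recovered
  from it afterwards.\<close>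

lemma homogeneous_system_nontrivial_solution:
  fixes g :: "'i \<Rightarrow> 'c \<Rightarrow> real"
  assumes "finite I" "finite C" "card I < card C"
  shows "\<exists>z. (\<exists>c\<in>C. z c \<noteq> 0) \<and> (\<forall>i\<in>I. (\<Sum>c\<in>C. z c * g i c) = 0)"
  using assms
proof (induction I arbitrary: C g rule: finite_induct)
  case empty
  then obtain c where "c \<in> C" by fastforce
  thus ?case by (intro exI[of _ "\<lambda>_. 1"]) auto
next
  case (insert i I)
  show ?case
  proof (cases "\<forall>c\<in>C. g i c = 0")
    case True
    have "card I < card C" using insert by simp
    from insert.IH[OF insert.prems(1) this]
    obtain z where z: "\<exists>c\<in>C. z c \<noteq> 0" "\<forall>j\<in>I. (\<Sum>c\<in>C. z c * g j c) = 0" by blast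
    moreover have "(\<Sum>c\<in>C. z c * g i c) = 0" using True by simp
    ultimately show ?thesis by blast
  next
    case False
    then obtain a where a: "a \<in> C" "g i a \<noteq> 0" by blast
    define g' where "g' j c = g j c - g j a * g i c / g i a" for j c
    have "card I < card (C - {a})" using insert a by simp
    with insert.IH[of "C - {a}" g'] insert.prems(1)
    obtain z where z: "\<exists>c\<in>C - {a}. z c \<noteq> 0" "\<And>j. j \<in> I \<Longrightarrow> (\<Sum>c\<in>C - {a}. z c * g' j c) = 0"
      by auto
    define y where "y c = (if c = a then - (\<Sum>c\<in>C - {a}. z c * g i c) / g i a else z c)" for c
    have sum_y: "(\<Sum>c\<in>C. y c * g j c) =
        - (\<Sum>c\<in>C - {a}. z c * g i c) / g i a * g j a + (\<Sum>c\<in>C - {a}. z c * g j c)" for j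
      using sum.remove[OF insert.prems(1) a(1), of "\<lambda>c. y c * g j c"]
      by (simp add: y_def cong: sum.cong_simp)
    have "(\<Sum>c\<in>C. y c * g j c) = 0" if "j \<in> insert i I" for j
    proof (cases "j = i")
      case True
      thus ?thesis using a(2) by (simp add: sum_y)
    next
      case False
      hence "(\<Sum>c\<in>C - {a}. z c * g' j c) = 0" using that z(2) by blast
      also have "(\<Sum>c\<in>C - {a}. z c * g' j c) =
          (\<Sum>c\<in>C - {a}. z c * g j c) - g j a / g i a * (\<Sum>c\<in>C - {a}. z c * g i c)"
        by (simp add: g'_def sum_subtractf sum_distrib_left algebra_simps)
      finally show ?thesis by (simp add: sum_y mult.commute)
    qed
    moreover have "\<exists>c\<in>C. y c \<noteq> 0" using z(1) by (auto simp: y_def)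
    ultimately show ?thesis by blast
  qed
qed

definition query_sequences :: "nat \<Rightarrow> nat \<Rightarrow> nat list set" where
  "query_sequences N t = {s. set s \<subseteq> {0..N} \<and> length s = t}"

text \<open>The entry \<open>0\<close> of a query sequence stands for the constant monomial.\<close>

definition query_monomial :: "concept \<Rightarrow> nat list \<Rightarrow> real" where
  "query_monomial c s = prod_list (map (\<lambda>y. if y = 0 then 1 else of_int (c y)) s)"

lemma finite_query_sequences: "finite (query_sequences N t)"
  unfolding query_sequences_def by (rule finite_lists_length_eq) simp

lemma card_query_sequences: "card (query_sequences N t) = (N + 1) ^ t"
  unfolding query_sequences_def by (subst card_lists_length_eq) auto

lemma sum_query_sequences_Suc:
  "(\<Sum>s\<in>query_sequences N (Suc t). F s) = (\<Sum>y\<in>{0..N}. \<Sum>s\<in>query_sequences N t. F (y # s))"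
proof -
  have "query_sequences N (Suc t) = (\<lambda>(y, s). y # s) ` ({0..N} \<times> query_sequences N t)"
    by (auto simp: query_sequences_def length_Suc_conv image_iff)
  moreover have "inj_on (\<lambda>(y, s). y # s) ({0..N} \<times> query_sequences N t)"
    by (auto simp: inj_on_def)
  ultimately show ?thesis
    by (simp add: sum.reindex sum.cartesian_product case_prod_unfold)
qed

text \<open>A query is affine in the values of \<open>c\<close>, so each one adds a single factor, 1
  or \<open>c y\<close>, to the monomials. The coefficients \<open>V\<close> are the same for all
  concepts.\<close>

lemma quantum_state_expansion:
  assumes psi: "\<psi> \<in> carrier_vec (2 * N * W)"
    and U: "\<And>s. s \<le> t \<Longrightarrow> unitary_mat (2 * N * W) (U s)"
  shows "\<exists>V. \<forall>c \<in> {1..N} \<rightarrow>\<^sub>E {-1, 1}. \<forall>i < 2 * N * W.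
    vec_index (quantum_state N W \<psi> U c t) i =
      (\<Sum>s\<in>query_sequences N t. complex_of_real (query_monomial c s) * V s i)"
  using U
proof (induction t)
  case 0
  have "query_sequences N 0 = {[]}" by (auto simp: query_sequences_def)
  thus ?case by (intro exI[of _ "\<lambda>_ i. vec_index (U 0 *\<^sub>v \<psi>) i"]) (simp add: query_monomial_def)
next
  case (Suc t)
  let ?d = "2 * N * W"
  let ?a = "\<lambda>c s. complex_of_real (query_monomial c s)"
  from Suc obtain V where V: "\<And>c i. c \<in> {1..N} \<rightarrow>\<^sub>E {-1, 1} \<Longrightarrow> i < ?d \<Longrightarrow>
    vec_index (quantum_state N W \<psi> U c t) i = (\<Sum>s\<in>query_sequences N t. ?a c s * V s i)"
    by fastforce
  have "\<forall>i. \<exists>x b w. i < ?d \<longrightarrow> x \<in> {1..N} \<and> b \<in> {-1, 1} \<and> w < W \<and> i = basis_index W x b w"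
  proof
    fix i
    show "\<exists>x b w. i < ?d \<longrightarrow> x \<in> {1..N} \<and> b \<in> {-1, 1} \<and> w < W \<and> i = basis_index W x b w"
    proof (cases "i < ?d")
      case True
      hence "i \<in> (\<lambda>(x, b, w). basis_index W x b w) ` ({1..N} \<times> {-1, 1} \<times> {..<W})"
        using basis_index_bij[of W N] by (simp add: bij_betw_def)
      then obtain q where q: "q \<in> {1..N} \<times> {-1, 1} \<times> {..<W}" "i = (\<lambda>(x, b, w). basis_index W x b w) q"
        by (rule imageE)
      obtain x b w where "q = (x, b, w)" by (cases q)
      with q have "x \<in> {1..N} \<and> b \<in> {-1, 1} \<and> w < W \<and> i = basis_index W x b w" by simp
      thus ?thesis by blast
    qed simp
  qed
  then obtain X B Y where XBY: "\<And>i. i < ?d \<Longrightarrow> X i \<in> {1..N} \<and> B i \<in> {-1, 1} \<and> Y i < W \<and>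
      i = basis_index W (X i) (B i) (Y i)" by metis
  define flip where "flip i = basis_index W (X i) (- B i) (Y i)" for i
  have flip: "flip i < ?d" if "i < ?d" for i
    unfolding flip_def using XBY[OF that] by (intro basis_index_less) auto
  \<comment> \<open>The amplitude is split under the flip of the answer bit. The oracle fixes the
    symmetric half, which is the term for 0, and multiplies the antisymmetric half by
    \<open>c (X i)\<close>.\<close>
  define E :: "nat \<Rightarrow> (nat \<Rightarrow> complex) \<Rightarrow> nat \<Rightarrow> complex" where
    "E y v i = (if y = 0 then (v i + v (flip i)) / 2
      else if y = X i then (v i - v (flip i)) / 2 else 0)" for y v i
  have E_sum: "E y (\<lambda>i. \<Sum>s\<in>A. f s * F s i) i = (\<Sum>s\<in>A. f s * E y (F s) i)"
    for y i f F and A :: "nat list set"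
  proof -
    have "((\<Sum>s\<in>A. f s * F s i) + (\<Sum>s\<in>A. f s * F s (flip i))) / 2 =
        (\<Sum>s\<in>A. f s * ((F s i + F s (flip i)) / 2))"
      unfolding sum.distrib[symmetric] sum_divide_distrib
      by (intro sum.cong refl) (simp add: distrib_left)
    moreover have "((\<Sum>s\<in>A. f s * F s i) - (\<Sum>s\<in>A. f s * F s (flip i))) / 2 =
        (\<Sum>s\<in>A. f s * ((F s i - F s (flip i)) / 2))"
      unfolding sum_subtractf[symmetric] sum_divide_distrib
      by (intro sum.cong refl) (simp add: right_diff_distrib)
    ultimately show ?thesis by (simp add: E_def del: times_divide_eq_right)
  qed
  have query: "vec_index (query_mat N W c *\<^sub>v v) i =
      (\<Sum>y\<in>{0..N}. ?a c [y] * E y (vec_index v) i)"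
    if c: "c \<in> {1..N} \<rightarrow>\<^sub>E {-1, 1}" and v: "v \<in> carrier_vec ?d" and i: "i < ?d" for c v i
  proof -
    have X: "X i \<in> {1..N}" and B: "B i \<in> {-1, 1}" and Y: "Y i < W"
      and idx: "basis_index W (X i) (B i) (Y i) = i"
      using XBY[OF i] by simp_all
    have "(\<Sum>y\<in>{0..N}. ?a c [y] * E y (vec_index v) i) =
        E 0 (vec_index v) i + (\<Sum>y\<in>{1..N}. ?a c [y] * E y (vec_index v) i)"
      by (simp add: sum.atLeast_Suc_atMost query_monomial_def)
    also have "(\<Sum>y\<in>{1..N}. ?a c [y] * E y (vec_index v) i) =
        (\<Sum>y\<in>{1..N}. if y = X i then of_int (c y) * ((vec_index v i - vec_index v (flip i)) / 2) else 0)"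
      by (intro sum.cong refl) (auto simp: E_def query_monomial_def)
    also have "\<dots> = of_int (c (X i)) * ((vec_index v i - vec_index v (flip i)) / 2)"
      using X by simp
    also have "E 0 (vec_index v) i = (vec_index v i + vec_index v (flip i)) / 2"
      by (simp add: E_def)
    finally have rhs: "(\<Sum>y\<in>{0..N}. ?a c [y] * E y (vec_index v) i) =
        (vec_index v i + vec_index v (flip i)) / 2 +
        of_int (c (X i)) * ((vec_index v i - vec_index v (flip i)) / 2)" .
    have lhs: "vec_index (query_mat N W c *\<^sub>v v) i = vec_index v (basis_index W (X i) (B i * c (X i)) (Y i))"
      using query_mat_mult_index[OF c v X B Y] by (simp only: idx)
    have "c (X i) \<in> {-1, 1}" using c X by (rule PiE_mem)
    thus ?thesis unfolding lhs rhs
      by (auto simp: idx flip_def[symmetric] add_divide_distrib diff_divide_distrib)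
  qed
  \<comment> \<open>The head of a sequence records the newest query, the tail the earlier
    ones.\<close>
  define V' where "V' l i = (\<Sum>k<?d. U (Suc t) $$ (i, k) * E (hd l) (V (tl l)) k)" for l i
  have "vec_index (quantum_state N W \<psi> U c (Suc t)) i =
      (\<Sum>l\<in>query_sequences N (Suc t). ?a c l * V' l i)"
    if c: "c \<in> {1..N} \<rightarrow>\<^sub>E {-1, 1}" and i: "i < ?d" for c i
  proof -
    let ?v = "quantum_state N W \<psi> U c t"
    have v: "?v \<in> carrier_vec ?d" using Suc.prems by (intro quantum_state_carrier psi) auto
    have UC: "U (Suc t) \<in> carrier_mat ?d ?d" using Suc.prems[of "Suc t"] by (simp add: unitary_mat_def)
    have Ev: "E y (vec_index ?v) k = (\<Sum>s\<in>query_sequences N t. ?a c s * E y (V s) k)"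
      if k: "k < ?d" for y k
    proof -
      have "E y (vec_index ?v) k = E y (\<lambda>i. \<Sum>s\<in>query_sequences N t. ?a c s * V s i) k"
        unfolding E_def V[OF c k] V[OF c flip[OF k]] ..
      thus ?thesis by (simp only: E_sum)
    qed
    have "vec_index (quantum_state N W \<psi> U c (Suc t)) i =
        (\<Sum>k<?d. U (Suc t) $$ (i, k) * vec_index (query_mat N W c *\<^sub>v ?v) k)"
      unfolding quantum_state.simps
      by (rule index_mult_mat_vec_sum[OF UC query_mat_mult_carrier[OF v] i])
    also have "\<dots> = (\<Sum>k<?d. U (Suc t) $$ (i, k) *
        (\<Sum>y\<in>{0..N}. ?a c [y] * (\<Sum>s\<in>query_sequences N t. ?a c s * E y (V s) k)))"
      by (intro sum.cong refl) (simp add: query[OF c v] Ev)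
    also have "\<dots> = (\<Sum>k<?d. \<Sum>y\<in>{0..N}. \<Sum>s\<in>query_sequences N t.
        ?a c (y # s) * (U (Suc t) $$ (i, k) * E y (V s) k))"
      unfolding sum_distrib_left
      by (intro sum.cong refl) (simp add: query_monomial_def mult_ac)
    also have "\<dots> = (\<Sum>y\<in>{0..N}. \<Sum>s\<in>query_sequences N t. \<Sum>k<?d.
        ?a c (y # s) * (U (Suc t) $$ (i, k) * E y (V s) k))"
      by (subst sum.swap, rule sum.cong[OF refl], rule sum.swap)
    also have "\<dots> = (\<Sum>l\<in>query_sequences N (Suc t). ?a c l * V' l i)"
      by (simp add: sum_query_sequences_Suc V'_def sum_distrib_left)
    finally show ?thesis .
  qed
  thus ?case by blast
qed

text \<open>The outcome probabilities \<open>P c c'\<close> have rank at most \<open>(N + 1) ^ (2 * T)\<close> as a matrix, and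
  this matrix is diagonally dominant, so it is nonsingular.\<close>

lemma quantum_learner_card_le:
  assumes C: "concept_class N C" and L: "quantum_learner N C T W \<psi> U M"
  shows "card C \<le> (N + 1) ^ (2 * T)"
proof (rule ccontr)
  assume big: "\<not> ?thesis"
  let ?d = "2 * N * W"
  let ?q = "\<lambda>c. quantum_state N W \<psi> U c T"
  let ?I = "query_sequences N T"
  have CE: "C \<subseteq> {1..N} \<rightarrow>\<^sub>E {-1, 1}" using C by (simp add: concept_class_def)
  have finC: "finite C" using C by (rule concept_class_finite)
  have L': "\<psi> \<in> carrier_vec ?d" "sq_norm \<psi> = 1"
    "\<And>t. t \<le> T \<Longrightarrow> unitary_mat ?d (U t)" "measurement ?d C M"
    "\<And>c. c \<in> C \<Longrightarrow> sq_norm (M c *\<^sub>v ?q c) \<ge> 2/3"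
    using L by (simp_all add: quantum_learner_def)
  define P where "P c c' = sq_norm (M c' *\<^sub>v ?q c)" for c c'
  have qcar: "?q c \<in> carrier_vec ?d" for c using L' by (intro quantum_state_carrier) auto
  have Mcar: "M c \<in> carrier_mat ?d ?d" if "c \<in> C" for c
    using L'(4) that by (simp add: measurement_def)
  have Pcar: "M c' *\<^sub>v ?q c \<in> carrier_vec ?d" if "c' \<in> C" for c c'
    using Mcar[OF that] qcar by (rule mult_mat_vec_carrier)
  have P0: "P c c' \<ge> 0" if "c' \<in> C" for c c'
    unfolding P_def by (rule sq_norm_nonneg[OF Pcar[OF that]])
  have P1: "(\<Sum>c'\<in>C. P c c') = 1" if "c \<in> C" for c
    unfolding P_def measurement_sum_sq_norm[OF L'(4) qcar]
    using L' CE that by (intro sq_norm_quantum_state) auto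
  from quantum_state_expansion[of \<psi> N W T U, OF L'(1,3)] obtain V where
    V: "\<And>c i. c \<in> {1..N} \<rightarrow>\<^sub>E {-1, 1} \<Longrightarrow> i < ?d \<Longrightarrow>
      vec_index (?q c) i = (\<Sum>s\<in>?I. complex_of_real (query_monomial c s) * V s i)" by blast
  \<comment> \<open>An outcome probability is a sum of amplitudes times their conjugates. It
    therefore factors through pairs of query sequences: \<open>f\<close> depends only on the input
    concept, \<open>G\<close> only on the outcome.\<close>
  define g where "g c' s i = (\<Sum>j<?d. M c' $$ (i, j) * V s j)" for c' s i
  define G where "G c' p = (\<Sum>i<?d. Re (g c' (fst p) i * cnj (g c' (snd p) i)))" for c' p
  define f where "f p c = query_monomial c (fst p) * query_monomial c (snd p)" for p c
  have P_eq: "P c c' = (\<Sum>p\<in>?I \<times> ?I. f p c * G c' p)" if c: "c \<in> C" and c': "c' \<in> C" for c c'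
  proof -
    let ?a = "query_monomial c"
    have cE: "c \<in> {1..N} \<rightarrow>\<^sub>E {-1, 1}" using c CE by blast
    have coord: "vec_index (M c' *\<^sub>v ?q c) i = (\<Sum>s\<in>?I. complex_of_real (?a s) * g c' s i)"
      if i: "i < ?d" for i
    proof -
      have "vec_index (M c' *\<^sub>v ?q c) i = (\<Sum>j<?d. \<Sum>s\<in>?I. complex_of_real (?a s) * (M c' $$ (i, j) * V s j))"
        unfolding index_mult_mat_vec_sum[OF Mcar[OF c'] qcar i]
        by (intro sum.cong refl) (simp add: V[OF cE] sum_distrib_left mult_ac)
      also have "\<dots> = (\<Sum>s\<in>?I. complex_of_real (?a s) * g c' s i)"
        by (subst sum.swap) (simp add: g_def sum_distrib_left)
      finally show ?thesis .
    qed
    have sq: "(cmod (vec_index (M c' *\<^sub>v ?q c) i))\<^sup>2 =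
        (\<Sum>p\<in>?I \<times> ?I. f p c * Re (g c' (fst p) i * cnj (g c' (snd p) i)))" if i: "i < ?d" for i
    proof -
      have "complex_of_real ((cmod (vec_index (M c' *\<^sub>v ?q c) i))\<^sup>2) =
          (\<Sum>s\<in>?I. complex_of_real (?a s) * g c' s i) * (\<Sum>s\<in>?I. complex_of_real (?a s) * cnj (g c' s i))"
        unfolding complex_norm_square coord[OF i] by simp
      also have "\<dots> = (\<Sum>p\<in>?I \<times> ?I. complex_of_real (f p c) * (g c' (fst p) i * cnj (g c' (snd p) i)))"
        unfolding sum_product sum.cartesian_product
        by (intro sum.cong refl) (simp add: f_def case_prod_unfold mult_ac)
      finally have "Re (complex_of_real ((cmod (vec_index (M c' *\<^sub>v ?q c) i))\<^sup>2)) =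
          Re (\<Sum>p\<in>?I \<times> ?I. complex_of_real (f p c) * (g c' (fst p) i * cnj (g c' (snd p) i)))"
        by (rule arg_cong)
      moreover have "Re (complex_of_real r * u) = r * Re u" for r u by simp
      ultimately show ?thesis by (simp only: Re_complex_of_real Re_sum)
    qed
    have "P c c' = (\<Sum>i<?d. \<Sum>p\<in>?I \<times> ?I. f p c * Re (g c' (fst p) i * cnj (g c' (snd p) i)))"
      unfolding P_def sq_norm_eq_sum[OF Pcar[OF c']] by (intro sum.cong refl) (simp add: sq)
    also have "\<dots> = (\<Sum>p\<in>?I \<times> ?I. f p c * G c' p)"
      by (subst sum.swap) (simp only: G_def sum_distrib_left)
    finally show ?thesis .
  qed
  \<comment> \<open>With fewer pairs than concepts, some nonzero \<open>z\<close> annihilates all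
    \<open>f p\<close>, and hence gives a linear relation between the rows of
    \<open>P\<close>.\<close>
  have "card (?I \<times> ?I) < card C"
    using big by (simp add: card_cartesian_product card_query_sequences mult_2 power_add)
  from homogeneous_system_nontrivial_solution[OF
      finite_cartesian_product[OF finite_query_sequences finite_query_sequences] finC this, of f]
  obtain z where z: "\<exists>c\<in>C. z c \<noteq> 0"
    and ker: "\<And>p. p \<in> ?I \<times> ?I \<Longrightarrow> (\<Sum>c\<in>C. z c * f p c) = 0" by blast
  have dominated: "2 * (\<bar>z c'\<bar> * P c' c') \<le> (\<Sum>c\<in>C. \<bar>z c\<bar> * P c c')" if c': "c' \<in> C" for c'
  proof -
    have "(\<Sum>c\<in>C. z c * P c c') = (\<Sum>c\<in>C. \<Sum>p\<in>?I \<times> ?I. G c' p * (z c * f p c))"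
      by (intro sum.cong refl) (simp add: P_eq[OF _ c'] sum_distrib_left mult_ac)
    also have "\<dots> = (\<Sum>p\<in>?I \<times> ?I. G c' p * (\<Sum>c\<in>C. z c * f p c))"
      by (subst sum.swap) (simp add: sum_distrib_left)
    also have "\<dots> = 0" by (rule sum.neutral) (use ker in auto)
    finally have "z c' * P c' c' = - (\<Sum>c\<in>C - {c'}. z c * P c c')"
      using sum.remove[OF finC c', of "\<lambda>c. z c * P c c'"] by simp
    hence "\<bar>z c'\<bar> * P c' c' = \<bar>\<Sum>c\<in>C - {c'}. z c * P c c'\<bar>"
      using P0[OF c'] by (metis abs_minus_cancel abs_mult abs_of_nonneg)
    also have "\<dots> \<le> (\<Sum>c\<in>C - {c'}. \<bar>z c\<bar> * P c c')"
      using sum_abs[of "\<lambda>c. z c * P c c'" "C - {c'}"] P0[OF c'] by (simp add: abs_mult)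
    finally show ?thesis
      using sum.remove[OF finC c', of "\<lambda>c. \<bar>z c\<bar> * P c c'"] by simp
  qed
  \<comment> \<open>Summing over all outcomes gives the contradiction: each diagonal entry is at
    least 2/3 and each row sums to 1, so 4/3 of the total of \<open>\<bar>z c\<bar>\<close> would be
    at most that total.\<close>
  have "4/3 * (\<Sum>c\<in>C. \<bar>z c\<bar>) \<le> (\<Sum>c\<in>C. 2 * (\<bar>z c\<bar> * P c c))"
    unfolding sum_distrib_left
  proof (rule sum_mono)
    fix c assume "c \<in> C"
    hence "2/3 \<le> P c c" using L'(5) by (simp add: P_def)
    hence "\<bar>z c\<bar> * (2/3) \<le> \<bar>z c\<bar> * P c c" by (rule mult_left_mono) simp
    thus "4/3 * \<bar>z c\<bar> \<le> 2 * (\<bar>z c\<bar> * P c c)" by simp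
  qed
  also have "\<dots> \<le> (\<Sum>c'\<in>C. \<Sum>c\<in>C. \<bar>z c\<bar> * P c c')"
    by (intro sum_mono dominated)
  also have "\<dots> = (\<Sum>c\<in>C. \<bar>z c\<bar> * (\<Sum>c'\<in>C. P c c'))"
    by (subst sum.swap) (simp add: sum_distrib_left)
  also have "\<dots> = (\<Sum>c\<in>C. \<bar>z c\<bar>)" by (simp add: P1)
  finally have "(\<Sum>c\<in>C. \<bar>z c\<bar>) \<le> 0" by simp
  moreover have "(\<Sum>c\<in>C. \<bar>z c\<bar>) > 0"
    using z finC by (metis abs_ge_zero sum_pos2 zero_less_abs_iff)
  ultimately show False by simp
qed


section \<open>Existence of quantum learners\<close>

lemma mat_adjoint_index:
  assumes "A \<in> carrier_mat n m" "i < m" "j < n"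
  shows "mat_adjoint A $$ (i, j) = cnj (A $$ (j, i))"
  using assms by (simp add: mat_adjoint_def mat_of_rows_def)

definition permutation_mat :: "nat \<Rightarrow> (nat \<Rightarrow> nat) \<Rightarrow> complex mat" where
  "permutation_mat d p = Matrix.mat d d (\<lambda>(i, j). if i = p j then 1 else 0)"

lemma unitary_permutation_mat:
  assumes p: "bij_betw p {..<d} {..<d}"
  shows "unitary_mat d (permutation_mat d p)"
proof -
  let ?P = "permutation_mat d p"
  have P: "?P \<in> carrier_mat d d" by (simp add: permutation_mat_def)
  have entry: "?P $$ (i, j) = (if i = p j then 1 else 0)" if "i < d" "j < d" for i j
    using that by (simp add: permutation_mat_def)
  have adj: "mat_adjoint ?P $$ (i, j) = (if j = p i then 1 else 0)" if "i < d" "j < d" for i j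
    using mat_adjoint_index[OF P that] entry[OF that(2,1)] by simp
  have A: "mat_adjoint ?P \<in> carrier_mat d d" using P by (auto simp: mat_adjoint_def)
  have pd: "p j < d" if "j < d" for j using p that by (auto simp: bij_betw_def)
  have inj: "p i = p j \<longleftrightarrow> i = j" if "i < d" "j < d" for i j
    using p that by (auto simp: bij_betw_def inj_on_def)
  have "mat_adjoint ?P * ?P = 1\<^sub>m d"
  proof (rule eq_matI)
    fix i j assume "i < dim_row (1\<^sub>m d :: complex mat)" "j < dim_col (1\<^sub>m d :: complex mat)"
    hence ij: "i < d" "j < d" by simp_all
    have "(mat_adjoint ?P * ?P) $$ (i, j) = (\<Sum>k<d. mat_adjoint ?P $$ (i, k) * ?P $$ (k, j))"
      using A P ij by (simp add: scalar_prod_def atLeast0LessThan)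
    also have "\<dots> = (\<Sum>k<d. if k = p i then if p i = p j then 1 else 0 else 0)"
      using ij by (intro sum.cong refl) (auto simp: adj entry)
    also have "\<dots> = (if p i = p j then 1 else 0)" using pd[OF ij(1)] by simp
    finally show "(mat_adjoint ?P * ?P) $$ (i, j) = 1\<^sub>m d $$ (i, j)"
      using ij inj[OF ij] by simp
  qed (use A P in auto)
  moreover have "?P * mat_adjoint ?P = 1\<^sub>m d"
  proof (rule eq_matI)
    fix i j assume "i < dim_row (1\<^sub>m d :: complex mat)" "j < dim_col (1\<^sub>m d :: complex mat)"
    hence ij: "i < d" "j < d" by simp_all
    obtain k where k: "k < d" "p k = i" using p ij(1) by (metis bij_betw_def imageE lessThan_iff)
    have "(?P * mat_adjoint ?P) $$ (i, j) = (\<Sum>k<d. ?P $$ (i, k) * mat_adjoint ?P $$ (k, j))"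
      using A P ij by (simp add: scalar_prod_def atLeast0LessThan)
    also have "\<dots> = (\<Sum>l<d. if l = k then if i = j then 1 else 0 else 0)"
      using ij k inj by (intro sum.cong refl) (auto simp: adj entry)
    also have "\<dots> = (if i = j then 1 else 0)" using k by simp
    finally show "(?P * mat_adjoint ?P) $$ (i, j) = 1\<^sub>m d $$ (i, j)"
      using ij by simp
  qed (use A P in auto)
  ultimately show ?thesis using P by (simp add: unitary_mat_def)
qed

lemma mult_mat_unit_vec_index:
  fixes A :: "complex mat"
  assumes "A \<in> carrier_mat d d" "i < d" "j < d"
  shows "vec_index (A *\<^sub>v unit_vec d j) i = A $$ (i, j)"
  using assms by simp

lemma permutation_mat_unit_vec:
  assumes "bij_betw p {..<d} {..<d}" "j < d"
  shows "permutation_mat d p *\<^sub>v unit_vec d j = unit_vec d (p j)"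
proof (rule eq_vecI)
  have P: "permutation_mat d p \<in> carrier_mat d d" by (simp add: permutation_mat_def)
  fix i assume "i < dim_vec (unit_vec d (p j) :: complex vec)"
  hence i: "i < d" by simp
  show "vec_index (permutation_mat d p *\<^sub>v unit_vec d j) i = vec_index (unit_vec d (p j)) i"
    unfolding mult_mat_unit_vec_index[OF P i assms(2)]
    using i assms(2) by (simp add: permutation_mat_def unit_vec_def)
qed (simp add: permutation_mat_def)

text \<open>The hypothesis makes \<open>g c \<mapsto> s c\<close> well defined and injective. The
  complements of its domain and range in the finite set \<open>A\<close> have equal size, so any
  bijection between them completes a permutation, which yields a unitary.\<close>

lemma bij_betw_extending_partial_map:
  assumes A: "finite A" and g: "g ` C \<subseteq> A" and s: "s ` C \<subseteq> A"
    and eq: "\<And>c c'. c \<in> C \<Longrightarrow> c' \<in> C \<Longrightarrow> g c = g c' \<longleftrightarrow> s c = s c'"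
  obtains p where "bij_betw p A A" "\<And>c. c \<in> C \<Longrightarrow> p (g c) = s c"
proof -
  define f where "f i = s (inv_into C g i)" for i
  have f: "f (g c) = s c" if c: "c \<in> C" for c
  proof -
    have "g (inv_into C g (g c)) = g c" "inv_into C g (g c) \<in> C"
      using c by (auto intro: f_inv_into_f inv_into_into)
    thus ?thesis using eq c by (simp add: f_def)
  qed
  have "inj_on f (g ` C)" using eq by (auto simp: inj_on_def f)
  moreover have "f ` g ` C = s ` C" by (force simp: f)
  ultimately have bij: "bij_betw f (g ` C) (s ` C)" by (simp add: bij_betw_def)
  have "card (A - g ` C) = card (A - s ` C)"
    using bij_betw_same_card[OF bij] A g s by (simp add: card_Diff_subset finite_subset)
  then obtain h where h: "bij_betw h (A - g ` C) (A - s ` C)"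
    using A by (metis bij_betw_iff_card finite_Diff)
  define p where "p i = (if i \<in> g ` C then f i else h i)" for i
  have "bij_betw p (g ` C) (s ` C)"
    using bij by (rule bij_betw_cong[THEN iffD1, rotated]) (simp add: p_def)
  moreover have "bij_betw p (A - g ` C) (A - s ` C)"
    using h by (rule bij_betw_cong[THEN iffD1, rotated]) (simp add: p_def)
  ultimately have "bij_betw p (g ` C \<union> (A - g ` C)) (s ` C \<union> (A - s ` C))"
    by (rule bij_betw_combine) auto
  moreover have "g ` C \<union> (A - g ` C) = A" "s ` C \<union> (A - s ` C) = A" using g s by auto
  ultimately have "bij_betw p A A" by simp
  moreover have "p (g c) = s c" if "c \<in> C" for c using that f by (simp add: p_def)
  ultimately show ?thesis by (rule that)
qed

lemma measurement_of_basis: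
  assumes "finite C" and out: "\<And>i. i < d \<Longrightarrow> out i \<in> C"
  defines "M \<equiv> \<lambda>c. Matrix.mat d d (\<lambda>(i, j). if i = j \<and> out i = c then 1 else 0 :: complex)"
  shows "measurement d C M"
    and "i < d \<Longrightarrow> sq_norm (M (out i) *\<^sub>v unit_vec d i) = 1"
proof -
  have M: "M c \<in> carrier_mat d d" for c by (simp add: M_def)
  have entry: "M c $$ (i, j) = (if i = j \<and> out i = c then 1 else 0)" if "i < d" "j < d" for c i j
    using that by (simp add: M_def)
  have adj: "(mat_adjoint (M c) * M c) $$ (i, j) = (if i = j \<and> out i = c then 1 else 0)"
    if ij: "i < d" "j < d" for c i j
  proof -
    have "(mat_adjoint (M c) * M c) $$ (i, j) = (\<Sum>k<d. cnj (M c $$ (k, i)) * M c $$ (k, j))"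
      using M[of c] ij by (simp add: mat_adjoint_def scalar_prod_def atLeast0LessThan)
    also have "\<dots> = (\<Sum>k<d. if k = i then if i = j \<and> out i = c then 1 else 0 else 0)"
      using ij by (intro sum.cong refl) (auto simp: entry)
    finally show ?thesis using ij by simp
  qed
  have "Matrix.mat d d (\<lambda>(i, j). \<Sum>c\<in>C. (mat_adjoint (M c) * M c) $$ (i, j)) = 1\<^sub>m d"
  proof (rule eq_matI)
    fix i j assume "i < dim_row (1\<^sub>m d :: complex mat)" "j < dim_col (1\<^sub>m d :: complex mat)"
    hence ij: "i < d" "j < d" by simp_all
    have "(\<Sum>c\<in>C. (mat_adjoint (M c) * M c) $$ (i, j)) = (\<Sum>c\<in>C. if c = out i then if i = j then 1 else 0 else 0)"
      using ij by (intro sum.cong refl) (auto simp: adj)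
    also have "\<dots> = (if i = j then 1 else 0)" using out[OF ij(1)] assms(1) by simp
    finally show "Matrix.mat d d (\<lambda>(i, j). \<Sum>c\<in>C. (mat_adjoint (M c) * M c) $$ (i, j)) $$ (i, j) =
        1\<^sub>m d $$ (i, j)" using ij by simp
  qed simp_all
  thus "measurement d C M" using M by (simp add: measurement_def)
  assume i: "i < d"
  have "M (out i) *\<^sub>v unit_vec d i = unit_vec d i"
  proof (rule eq_vecI)
    fix j assume "j < dim_vec (unit_vec d i :: complex vec)"
    hence j: "j < d" by simp
    show "vec_index (M (out i) *\<^sub>v unit_vec d i) j = vec_index (unit_vec d i) j"
      unfolding mult_mat_unit_vec_index[OF M j i] using i j by (auto simp: entry unit_vec_def)
  qed (use carrier_matD(1)[OF M] in simp)
  thus "sq_norm (M (out i) *\<^sub>v unit_vec d i) = 1" using i by (simp add: sq_norm_unit_vec)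
qed

text \<open>A learner that queries \<open>1, \<dots>, N\<close> in turn and stores an injective code of the answers seen so
  far in its workspace.\<close>

lemma quantum_learner_exists:
  assumes N: "N \<ge> 1" and C: "concept_class N C"
  shows "\<exists>T W \<psi> U M. quantum_learner N C T W \<psi> U M"
proof -
  have CE: "C \<subseteq> {1..N} \<rightarrow>\<^sub>E {-1, 1}" and "C \<noteq> {}" using C by (simp_all add: concept_class_def)
  have finC: "finite C" using C by (rule concept_class_finite)
  obtain c0 where c0: "c0 \<in> C" using \<open>C \<noteq> {}\<close> by blast
  define prefixes where "prefixes = (\<Union>t\<in>{..N}. (\<lambda>c. restrict c {1..t}) ` C)"
  have "finite prefixes" using finC by (simp add: prefixes_def)
  from finite_imp_inj_to_nat_seg[OF this] obtain code :: "concept \<Rightarrow> nat" and W where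
    code: "code ` prefixes = {i. i < W}" "inj_on code prefixes"
    by blast
  define e where "e t c = code (restrict c {1..t})" for t and c :: concept
  have mem: "restrict c {1..t} \<in> prefixes" if "c \<in> C" "t \<le> N" for c t
    using that by (auto simp: prefixes_def)
  have eW: "e t c < W" if "c \<in> C" "t \<le> N" for c t
    using mem[OF that] code(1) by (auto simp: e_def)
  have e_eq: "e t c = e t c' \<longleftrightarrow> restrict c {1..t} = restrict c' {1..t}"
    if "c \<in> C" "c' \<in> C" "t \<le> N" for c c' t
    unfolding e_def by (rule inj_on_eq_iff[OF code(2)]) (use mem that in auto)
  let ?d = "2 * N * W"
  \<comment> \<open>At \<open>t = N\<close> no query remains and the position 1 is only a valid
    placeholder for the final state.\<close>
  define pos where "pos t = (if t < N then Suc t else 1)" for t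
  have pos: "pos t \<in> {1..N}" for t using N by (simp add: pos_def)
  define s where "s t c = basis_index W (pos t) 1 (e t c)" for t c
  define g where "g t c = basis_index W (pos t) (c (pos t)) (e t c)" for t and c :: concept
  have cval: "c x \<in> {-1, 1}" if "c \<in> C" "x \<in> {1..N}" for c x
    using CE that by (meson PiE_mem subsetD)
  have s_less: "s t c < ?d" and g_less: "g t c < ?d" if "c \<in> C" "t \<le> N" for c t
    unfolding s_def g_def using pos eW[OF that] by (auto intro!: basis_index_less simp del: atLeastAtMost_iff)
  have s_eq: "s t c = s t c' \<longleftrightarrow> e t c = e t c'" if "c \<in> C" "c' \<in> C" "t \<le> N" for c c' t
    using basis_index_inj[of W "pos t" 1 "e t c" "pos t" 1 "e t c'" N] pos eW that
    by (auto simp: s_def simp del: atLeastAtMost_iff)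
  have g_eq: "g t c = g t c' \<longleftrightarrow> c (pos t) = c' (pos t) \<and> e t c = e t c'"
    if "c \<in> C" "c' \<in> C" "t \<le> N" for c c' t
    using basis_index_inj[of W "pos t" "c (pos t)" "e t c" "pos t" "c' (pos t)" "e t c'" N]
      pos[of t] eW cval[OF that(1) pos[of t]] cval[OF that(2) pos[of t]] that
    by (auto simp: g_def simp del: atLeastAtMost_iff insert_iff)
  \<comment> \<open>The state \<open>g t c\<close> right after a query holds the first
    \<open>t\<close> answers and the new one. This is the information encoded by
    \<open>s (Suc t) c\<close>, so a permutation can record the answer and reset the answer
    bit.\<close>
  have "\<exists>p. bij_betw p {..<?d} {..<?d} \<and> (\<forall>c\<in>C. p (g t c) = s (Suc t) c)" if t: "t < N" for t
  proof -
    have restrict_eq: "restrict c A = restrict c' A \<longleftrightarrow> (\<forall>x\<in>A. c x = c' x)"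
      for c c' :: concept and A by (metis restrict_apply' restrict_ext)
    have "g t c = g t c' \<longleftrightarrow> s (Suc t) c = s (Suc t) c'" if cc: "c \<in> C" "c' \<in> C" for c c'
    proof -
      have "{1..Suc t} = insert (Suc t) {1..t}" by auto
      hence "restrict c {1..Suc t} = restrict c' {1..Suc t} \<longleftrightarrow>
          c (Suc t) = c' (Suc t) \<and> restrict c {1..t} = restrict c' {1..t}"
        unfolding restrict_eq by (simp only: ball_simps)
      thus ?thesis
        using cc t by (simp add: g_eq s_eq e_eq pos_def del: restrict_apply)
    qed
    moreover have "g t ` C \<subseteq> {..<?d}" "s (Suc t) ` C \<subseteq> {..<?d}"
      using t g_less s_less by (auto simp: Suc_le_eq)
    ultimately obtain p where "bij_betw p {..<?d} {..<?d}" "\<And>c. c \<in> C \<Longrightarrow> p (g t c) = s (Suc t) c"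
      using bij_betw_extending_partial_map[of "{..<?d}" "g t" C "s (Suc t)"] by blast
    thus ?thesis by blast
  qed
  then obtain p where p: "\<And>t. t < N \<Longrightarrow> bij_betw (p t) {..<?d} {..<?d}"
    "\<And>t c. t < N \<Longrightarrow> c \<in> C \<Longrightarrow> p t (g t c) = s (Suc t) c" by metis
  define U where "U t = (if t = 0 then 1\<^sub>m ?d else permutation_mat ?d (p (t - 1)))" for t
  define \<psi> :: "complex vec" where "\<psi> = unit_vec ?d (s 0 c0)"
  have state: "quantum_state N W \<psi> U c t = unit_vec ?d (s t c)" if c: "c \<in> C" and t: "t \<le> N" for c t
    using t
  proof (induction t)
    case 0
    \<comment> \<open>The empty prefix is shared by all concepts, so the initial state does not
      depend on the target.\<close>
    have "s 0 c = s 0 c0" by (simp add: s_def e_def restrict_def)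
    thus ?case by (simp add: U_def \<psi>_def)
  next
    case (Suc t)
    have cE: "c \<in> {1..N} \<rightarrow>\<^sub>E {-1, 1}" using c CE by blast
    have "query_mat N W c *\<^sub>v unit_vec ?d (s t c) = unit_vec ?d (g t c)"
      unfolding s_def g_def
      using query_mat_basis[OF cE pos[of t], of 1 "e t c" W] eW[OF c, of t] Suc.prems by simp
    thus ?case
      using Suc p[of t] c g_less[of c t] permutation_mat_unit_vec[of "p t" ?d "g t c"]
      by (simp add: U_def)
  qed
  define out where "out i = (if i \<in> s N ` C then inv_into C (s N) i else c0)" for i
  have out: "out i \<in> C" for i using c0 by (simp add: out_def inv_into_into)
  have "inj_on (s N) C"
  proof (rule inj_onI)
    fix c c' assume cc: "c \<in> C" "c' \<in> C" "s N c = s N c'"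
    hence "restrict c {1..N} = restrict c' {1..N}" by (simp add: s_eq e_eq)
    thus "c = c'" using cc CE by (metis PiE_restrict subsetD)
  qed
  hence out_s: "out (s N c) = c" if "c \<in> C" for c using that by (simp add: out_def)
  define M where "M c = Matrix.mat ?d ?d (\<lambda>(i, j). if i = j \<and> out i = c then 1 else 0 :: complex)" for c
  have "quantum_learner N C N W \<psi> U M"
    unfolding quantum_learner_def
  proof (intro conjI allI impI ballI)
    show "\<psi> \<in> carrier_vec ?d" by (simp add: \<psi>_def)
    show "sq_norm \<psi> = 1" unfolding \<psi>_def by (rule sq_norm_unit_vec) (use s_less c0 in simp)
    show "unitary_mat ?d (U t)" if "t \<le> N" for t
    proof (cases "t = 0")
      case True
      have "mat_adjoint (1\<^sub>m ?d :: complex mat) = 1\<^sub>m ?d"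
      proof (rule eq_matI)
        fix i j assume "i < dim_row (1\<^sub>m ?d :: complex mat)" "j < dim_col (1\<^sub>m ?d :: complex mat)"
        thus "mat_adjoint (1\<^sub>m ?d :: complex mat) $$ (i, j) = 1\<^sub>m ?d $$ (i, j)"
          by (auto simp: mat_adjoint_index[of _ ?d ?d])
      qed (simp_all add: mat_adjoint_def)
      with True show ?thesis by (simp add: U_def unitary_mat_def)
    next
      case False
      with that show ?thesis by (auto simp: U_def intro!: unitary_permutation_mat p)
    qed
    show "measurement ?d C M"
      unfolding M_def using finC out by (rule measurement_of_basis(1))
    fix c assume c: "c \<in> C"
    have "sq_norm (M (out (s N c)) *\<^sub>v unit_vec ?d (s N c)) = 1"
      unfolding M_def using finC out s_less[OF c le_refl] by (rule measurement_of_basis(2))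
    thus "1 - sq_norm (M c *\<^sub>v quantum_state N W \<psi> U c N) \<le> 1/3"
      using c by (simp add: state out_s)
  qed
  thus ?thesis by blast
qed


section \<open>Query complexities\<close>

text \<open>The \<open>LEAST\<close> in \<open>Q\<close> denotes an attained minimum only because
  some learner exists.\<close>

lemma quantum_learner_Q:
  assumes "N \<ge> 1" "concept_class N C"
  obtains W \<psi> U M where "quantum_learner N C (Q N C) W \<psi> U M"
  using LeastI_ex[OF quantum_learner_exists[OF assms]] unfolding Q_def[symmetric] by blast

lemma log_card_le_Q:
  assumes "N \<ge> 1" "concept_class N C"
  shows "log 2 (real (card C)) \<le> 2 * real (Q N C) * log 2 (real N + 1)"
proof -
  obtain W \<psi> U M where "quantum_learner N C (Q N C) W \<psi> U M"
    using quantum_learner_Q[OF assms] .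
  hence "card C \<le> (N + 1) ^ (2 * Q N C)" by (rule quantum_learner_card_le[OF assms(2)])
  hence "real (card C) \<le> (real N + 1) ^ (2 * Q N C)"
    by (metis Suc_eq_plus1 of_nat_Suc of_nat_le_iff of_nat_power add.commute)
  moreover have "card C > 0"
    using assms(2) concept_class_finite[OF assms(2)] by (simp add: concept_class_def card_gt_0_iff)
  ultimately have "log 2 (real (card C)) \<le> log 2 ((real N + 1) ^ (2 * Q N C))"
    by (intro log_mono) auto
  thus ?thesis by (simp add: log_nat_power)
qed

text \<open>Without queries, the polynomial bound on the number of concepts is 1.\<close>

lemma Q_pos:
  assumes N: "N \<ge> 1" and C: "concept_class N C" and card: "card C \<ge> 2"
  shows "Q N C \<ge> 1"
proof (rule ccontr)
  assume "\<not> ?thesis"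
  hence "card C \<le> (N + 1) ^ (2 * 0)"
    using quantum_learner_Q[OF N C] quantum_learner_card_le[OF C] by (metis One_nat_def less_one not_le)
  thus False using card by simp
qed

lemma R_singleton: "R N {c} = 0"
proof -
  have "classical_learner N {c} 0 (return_pmf (Output c))"
    by (simp add: classical_learner_def)
  thus ?thesis unfolding R_def by (intro Least_equality) auto
qed

text \<open>The quantum learner supplies the dichotomy that the entropy argument needs, with
  \<open>m = 50 * Q N C\<close>. It holds for every weighting, so multiplicative weights
  apply.\<close>

lemma R_le:
  assumes N: "N \<ge> 1" and C: "concept_class N C" and card: "card C \<ge> 2"
    and n: "real n * (ln (50 * real (Q N C)) / (2 * (50 * real (Q N C))\<^sup>2)) \<ge> 12 * ln (real (card C))"
  shows "R N C \<le> n"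
proof -
  have CE: "C \<subseteq> {1..N} \<rightarrow>\<^sub>E {-1, 1}" and ne: "C \<noteq> {}" using C by (simp_all add: concept_class_def)
  have fin: "finite C" using C by (rule concept_class_finite)
  obtain W \<psi> U M where L: "quantum_learner N C (Q N C) W \<psi> U M"
    using quantum_learner_Q[OF N C] .
  have tree: "\<exists>t\<in>{t. well_formed_tree N C t \<and> depth t \<le> n}.
      sum w {c \<in> C. \<not> run_tree t c = c} \<le> sum w C / 4"
    if w: "\<And>c. c \<in> C \<Longrightarrow> w c > 0" for w :: "concept \<Rightarrow> real"
  proof -
    have query: "(\<exists>a\<in>S. w a \<ge> 5/6 * sum w S) \<or>
        (\<exists>x\<in>{1..N}. \<forall>b\<in>{-1, 1}. sum w {c \<in> S. c x = b} * (50 * real (Q N C))\<^sup>2 \<ge> sum w S)"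
      if S: "S \<subseteq> C" "S \<noteq> {}" for S
    proof -
      show ?thesis
      proof (rule quantum_learner_balanced_query[of N C "Q N C" W \<psi> U M S w, OF C L S])
        show "w c \<ge> 0" if "c \<in> S" for c using that S w by (intro less_imp_le) blast
      next
        fix a assume "a \<in> S" "w a \<ge> 5/6 * sum w S"
        thus ?thesis by (intro disjI1 bexI[of _ a])
      next
        fix x assume x: "x \<in> {1..N}"
          "\<And>b. b \<in> {-1, 1} \<Longrightarrow> sum w {c \<in> S. c x = b} * (50 * real (Q N C))\<^sup>2 \<ge> sum w S"
        show ?thesis by (intro disjI2 bexI[of _ x] ballI x)
      qed
    qed
    have m: "50 * real (Q N C) > 1" using Q_pos[OF N C card] by simp
    obtain t where "well_formed_tree N C t \<and> depth t \<le> n \<and>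
        sum w {c \<in> C. run_tree t c \<noteq> c} \<le> sum w C / 4"
      using accurate_decision_tree[of C N "50 * real (Q N C)" w n, OF fin CE card m w query n] by (rule exE)
    thus ?thesis by (intro bexI[of _ t]) simp_all
  qed
  obtain D where D: "set_pmf D \<subseteq> {t. well_formed_tree N C t \<and> depth t \<le> n}"
    "\<And>c. c \<in> C \<Longrightarrow> measure_pmf.prob D {t. \<not> run_tree t c = c} \<le> 1/3"
    using multiplicative_weights[of C "{t. well_formed_tree N C t \<and> depth t \<le> n}"
        "\<lambda>t c. run_tree t c = c", OF fin ne tree] by blast
  hence "classical_learner N C n D" unfolding classical_learner_def by auto
  thus ?thesis unfolding R_def by (intro Least_le) blast
qed

theorem mainTheorem5:
  shows "\<exists>K > (0::real). \<forall>N \<ge> (1::nat). \<forall>C. concept_class N C \<longrightarrow>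
    real (R N C)
      \<le> K * ((real (Q N C))\<^sup>2 / max 1 (log 2 (real (Q N C))) * log 2 (real (card C))) \<and>
    (N \<ge> 2 \<longrightarrow>
      (real (Q N C))\<^sup>2 / max 1 (log 2 (real (Q N C))) * log 2 (real (card C))
        \<le> K * ((real (Q N C)) ^ 3 / max 1 (log 2 (real (Q N C))) * log 2 (real N)))"
\<comment> \<open>140000 = 14 * 10000: the entropy gain per query is at least
  \<open>l / (10000 * q\<^sup>2)\<close>, and the number of queries is at most 14 times the
  logarithm of the class size divided by that gain.\<close>
proof (intro exI[of _ "140000 :: real"] conjI allI impI)
  show "(0 :: real) < 140000" by simp
  fix N :: nat and C
  assume N: "1 \<le> N" and C: "concept_class N C"
  define q where "q = real (Q N C)"
  \<comment> \<open>The maximum keeps the divisor positive when \<open>q\<close> is at most 1, where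
    the logarithm is not.\<close>
  define l where "l = max 1 (log 2 q)"
  have l1: "l \<ge> 1" by (simp add: l_def)
  have ne: "C \<noteq> {}" using C by (simp add: concept_class_def)
  have fin: "finite C" using C by (rule concept_class_finite)
  have "card C \<noteq> 0" using ne fin by simp
  have "real (R N C) \<le> 140000 * (q\<^sup>2 / l * log 2 (real (card C)))"
  \<comment> \<open>For a single concept the right-hand side is 0, so rounding up to a whole query
    cannot be absorbed and \<open>R\<close> has to vanish exactly.\<close>
  proof (cases "card C = 1")
    case True
    then obtain c where "C = {c}" by (rule card_1_singletonE)
    thus ?thesis by (simp add: R_singleton)
  next
    case False
    hence card: "card C \<ge> 2" using \<open>card C \<noteq> 0\<close> by simp
    define L where "L = ln (real (card C))"
    define h where "h = ln (50 * q) / (2 * (50 * q)\<^sup>2)"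
    have q1: "q \<ge> 1" using Q_pos[OF N C card] by (simp add: q_def)
    have ln2: "ln 2 \<ge> (1/2 :: real)" using ln2_ge_two_thirds by simp
    have "ln (50 * q) \<ge> l / 2"
    proof -
      have "ln 2 \<le> ln (50 * q)" "ln q \<le> ln (50 * q)" using q1 by simp_all
      moreover have "log 2 q / 2 \<le> ln q"
      proof -
        have "log 2 q * (1/2) \<le> log 2 q * ln 2" using ln2 q1 by (intro mult_left_mono) auto
        thus ?thesis by (simp add: log_def)
      qed
      ultimately show ?thesis using ln2 by (simp add: l_def max_def)
    qed
    \<comment> \<open>The denominator of \<open>h\<close> is 5000 q^2, and another factor 2 is lost
      in \<open>ln (50 * q) \<ge> l / 2\<close>.\<close>
    hence h: "h \<ge> l / (10000 * q\<^sup>2)" "h > 0"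
      using q1 l1 by (simp_all add: h_def power_mult_distrib field_simps)
    have "ln 2 \<le> L" using card by (simp add: L_def)
    hence L: "L \<ge> 1/2" using ln2 by simp
    have "L \<le> log 2 (real (card C))"
    proof -
      have "L * ln 2 \<le> L * 1" using L ln_2_less_1 by (intro mult_left_mono) auto
      thus ?thesis by (simp add: L_def log_def field_simps)
    qed
    have h1: "h \<le> 1"
    proof -
      have "ln (50 * q) \<le> 50 * q" using q1 by (intro less_imp_le ln_less_self) simp
      also have "\<dots> \<le> 2 * (50 * q)\<^sup>2" using q1 by (simp add: power2_eq_square)
      finally show ?thesis using q1 by (simp add: h_def)
    qed
    define n where "n = nat \<lceil>12 * L / h\<rceil>"
    have "12 * L / h \<le> real n" unfolding n_def by (rule real_nat_ceiling_ge)
    hence "12 * L \<le> real n * h" using h(2) by (simp add: pos_divide_le_eq)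
    hence "R N C \<le> n" by (intro R_le[OF N C card]) (simp add: L_def h_def q_def)
    hence "real (R N C) \<le> real n" by simp
    also have "\<dots> \<le> 12 * L / h + 1"
      unfolding n_def using L h(2) by (simp add: of_nat_nat ceiling_correct)
    \<comment> \<open>The 1 from rounding up is absorbed because \<open>L\<close> is at least 1/2
      and \<open>h\<close> at most 1.\<close>
    also have "\<dots> \<le> 12 * L / h + 2 * L / h"
    proof (rule add_left_mono)
      show "1 \<le> 2 * L / h" using L h(2) h1 by (simp add: pos_le_divide_eq)
    qed
    also have "\<dots> = 14 * L / h" by (simp add: add_divide_distrib[symmetric])
    also have "14 * L / h \<le> 14 * L / (l / (10000 * q\<^sup>2))"
      using h L l1 q1 by (intro divide_left_mono mult_pos_pos) auto
    also have "\<dots> = 140000 * (q\<^sup>2 / l * L)" by simp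
    also have "\<dots> \<le> 140000 * (q\<^sup>2 / l * log 2 (real (card C)))"
      using \<open>L \<le> log 2 (real (card C))\<close> l1 by (intro mult_left_mono) auto
    finally show ?thesis .
  qed
  thus "real (R N C) \<le> 140000 * ((real (Q N C))\<^sup>2 / max 1 (log 2 (real (Q N C))) * log 2 (real (card C)))"
    by (simp add: q_def l_def)
  assume N2: "2 \<le> N"
  \<comment> \<open>This uses N \<ge> 2; for \<open>N = 1\<close> the logarithm of \<open>N\<close>
    would vanish while that of \<open>N + 1\<close> would not.\<close>
  have "log 2 (real N + 1) \<le> log 2 ((real N)\<^sup>2)"
  proof (rule log_mono)
    have "real N + 1 \<le> 2 * real N" using N2 by simp
    also have "\<dots> \<le> real N * real N" using N2 by (intro mult_right_mono) auto
    finally show "real N + 1 \<le> (real N)\<^sup>2" by (simp add: power2_eq_square)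
  qed auto
  hence "log 2 (real N + 1) \<le> 2 * log 2 (real N)" using N2 by (simp add: log_nat_power)
  hence "2 * q * log 2 (real N + 1) \<le> 2 * q * (2 * log 2 (real N))"
    by (intro mult_left_mono) (auto simp: q_def)
  hence "log 2 (real (card C)) \<le> 4 * q * log 2 (real N)"
    using log_card_le_Q[OF N C] by (simp add: q_def)
  hence "q\<^sup>2 / l * log 2 (real (card C)) \<le> q\<^sup>2 / l * (4 * q * log 2 (real N))"
    using l1 by (intro mult_left_mono) auto
  also have "\<dots> = 4 * (q ^ 3 / l * log 2 (real N))"
    by (simp add: power2_eq_square power3_eq_cube)
  also have "\<dots> \<le> 140000 * (q ^ 3 / l * log 2 (real N))"
    using N2 l1 by (intro mult_right_mono) (auto simp: q_def)
  finally show "(real (Q N C))\<^sup>2 / max 1 (log 2 (real (Q N C))) * log 2 (real (card C))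
      \<le> 140000 * ((real (Q N C)) ^ 3 / max 1 (log 2 (real (Q N C))) * log 2 (real N))"
    by (simp only: q_def l_def)
qed

end
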